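(* Let $1<p<\infty$, $p'=\frac{p}{p-1}$, and fix $\mathcal{I}=[0,\pi_{2,p'}]$. Let $E_2: W^{2,p}_{\mathrm D}(\mathcal I)\hookrightarrow L^{p'}(\mathcal I)$ be the identity embedding. Then $$\|E_2\|=\sup_{0\ne f\in W^{2,p}_{\mathrm D}(\mathcal I)}\frac{\|f\|_{L^{p'}}}{\|f''\|_{L^p}}=\left(\frac{2}{p'}\right)^{\frac{2}{p'}}\left(\operatorname{B}\!\left(\frac12,\frac{p'+1}{p'}\right)\right)^{\frac1{p'}-\frac1p},$$ and the extremal functions are of the form $f(t)=c\,\sin_{2,p'}(t)$, where $c\in\mathbb R$ is a non-zero constant.
   Context: $\operatorname{B}(a,b)=\int_0^1 s^{a-1}(1-s)^{b-1}\,ds$ is the Beta function. For $1<r,s<\infty$, with $r'=\frac{r}{r-1}$, $$\pi_{r,s}=2\int_0^1\frac{d\tau}{(1-\tau^s)^{1/r}}=\frac2s\operatorname{B}\!\left(\frac1s,\frac1{r'}\right),$$ and $\sin_{r,s}:\mathbb R\to[-1,1]$ is the $2\pi_{r,s}$-periodic odd function, even with respect to the point $\frac{\pi_{r,s}}2$, whose inverse on $[0,\frac{\pi_{r,s}}2]$ is $y\mapsto\int_0^y\frac{d\tau}{(1-\tau^s)^{1/r}}$, $y\in[0,1]$. For $\mathcal I=[0,t_0]$, $W^{2,p}_{\mathrm D}(\mathcal I)=\{u\in W^{2,p}(\mathcal I): u(0)=u(t_0)=0\}$ (real Sobolev space), equipped with the norm $\|u\|_{W^{2,p}_{\mathrm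 D}}=\|u''\|_{L^p(\mathcal I)}$. An extremal function is a non-zero $f\in W^{2,p}_{\mathrm D}(\mathcal I)$ attaining the supremum. *)

theory Defs
  imports "HOL-Analysis.Analysis"
begin

section \<open>Generalised trigonometric functions\<close>

text \<open>The integrand is unbounded at 1, so these are Lebesgue integrals. The value 0 that
  the integrand receives at 1 (division by zero) is immaterial.\<close>

definition gen_arcsin :: "real \<Rightarrow> real \<Rightarrow> real \<Rightarrow> real" where
  "gen_arcsin r s y = (LINT \<tau>:{0..y}|lborel. 1 / (1 - \<tau> powr s) powr (1 / r))"

definition gen_pi :: "real \<Rightarrow> real \<Rightarrow> real" where
  "gen_pi r s = 2 * (LINT \<tau>:{0..1}|lborel. 1 / (1 - \<tau> powr s) powr (1 / r))"

text \<open>For \<open>1 < r, s\<close> the function \<open>gen_arcsin r s\<close> is an increasing bijection from \<open>[0, 1]\<close>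
  onto \<open>[0, gen_pi r s / 2]\<close>. So the last conjunct says that it is the inverse of \<open>f\<close> on the
  latter interval, and the conjuncts together determine \<open>f\<close> uniquely.\<close>

definition gen_sin :: "real \<Rightarrow> real \<Rightarrow> real \<Rightarrow> real" where
  "gen_sin r s = (THE f.
     (\<forall>x. f x \<in> {-1..1}) \<and>
     (\<forall>x. f (x + 2 * gen_pi r s) = f x) \<and>
     (\<forall>x. f (- x) = - f x) \<and>
     (\<forall>x. f (gen_pi r s / 2 + x) = f (gen_pi r s / 2 - x)) \<and>
     (\<forall>y\<in>{0..1}. f (gen_arcsin r s y) = y))"

section \<open>Lebesgue and Sobolev spaces on an interval\<close>

text \<open>Elements of all spaces are functions rather than classes modulo null sets, and their
  values outside the interval \<open>I\<close> are irrelevant.\<close>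

definition Lp_space :: "real \<Rightarrow> real set \<Rightarrow> (real \<Rightarrow> real) set" where
  "Lp_space p I = {u \<in> borel_measurable (lebesgue_on I).
     integrable (lebesgue_on I) (\<lambda>x. \<bar>u x\<bar> powr p)}"

definition Lp_norm :: "real \<Rightarrow> real set \<Rightarrow> (real \<Rightarrow> real) \<Rightarrow> real" where
  "Lp_norm p I u = (integral\<^sup>L (lebesgue_on I) (\<lambda>x. \<bar>u x\<bar> powr p)) powr (1 / p)"

definition test_functions :: "real set \<Rightarrow> (real \<Rightarrow> real) set" where
  "test_functions I = {\<phi>. (\<forall>n x. (deriv ^^ n) \<phi> differentiable (at x)) \<and>
     compact (closure {x. \<phi> x \<noteq> 0}) \<and> closure {x. \<phi> x \<noteq> 0} \<subseteq> interior I}"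

definition locally_integrable :: "real set \<Rightarrow> (real \<Rightarrow> real) \<Rightarrow> bool" where
  "locally_integrable I u \<longleftrightarrow> (\<forall>K. compact K \<and> K \<subseteq> interior I \<longrightarrow> set_integrable lebesgue K u)"

definition has_weak_deriv :: "nat \<Rightarrow> real set \<Rightarrow> (real \<Rightarrow> real) \<Rightarrow> (real \<Rightarrow> real) \<Rightarrow> bool" where
  "has_weak_deriv k I u v \<longleftrightarrow> locally_integrable I u \<and> locally_integrable I v \<and>
     (\<forall>\<phi>\<in>test_functions I.
        integral\<^sup>L (lebesgue_on I) (\<lambda>x. u x * (deriv ^^ k) \<phi> x) =
        (-1) ^ k * integral\<^sup>L (lebesgue_on I) (\<lambda>x. v x * \<phi> x))"

text \<open>Weak derivatives are unique up to null sets; this selects a representative.\<close>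

definition weak_deriv :: "nat \<Rightarrow> real set \<Rightarrow> (real \<Rightarrow> real) \<Rightarrow> real \<Rightarrow> real" where
  "weak_deriv k I u = (SOME v. has_weak_deriv k I u v)"

definition Sobolev :: "nat \<Rightarrow> real \<Rightarrow> real set \<Rightarrow> (real \<Rightarrow> real) set" where
  "Sobolev k p I =
     {u \<in> Lp_space p I. \<forall>j\<in>{1..k}. \<exists>v\<in>Lp_space p I. has_weak_deriv j I u v}"

text \<open>The boundary values of a Sobolev class are those of its unique continuous representative;
  hence the continuity requirement, which selects this representative.\<close>

definition W2D :: "real \<Rightarrow> real \<Rightarrow> (real \<Rightarrow> real) set" where
  "W2D p t0 = {u \<in> Sobolev 2 p {0..t0}. continuous_on {0..t0} u \<and> u 0 = 0 \<and> u t0 = 0}"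

definition W2D_norm :: "real \<Rightarrow> real \<Rightarrow> (real \<Rightarrow> real) \<Rightarrow> real" where
  "W2D_norm p t0 u = Lp_norm p {0..t0} (weak_deriv 2 {0..t0} u)"

definition W2D_nonzero :: "real \<Rightarrow> real \<Rightarrow> (real \<Rightarrow> real) set" where
  "W2D_nonzero p t0 = {u \<in> W2D p t0. \<exists>t\<in>{0..t0}. u t \<noteq> 0}"

section \<open>The embedding, its norm and its extremal functions\<close>

definition op_norm ::
  "'a set \<Rightarrow> ('a \<Rightarrow> real) \<Rightarrow> ('b \<Rightarrow> real) \<Rightarrow> ('a \<Rightarrow> 'b) \<Rightarrow> real" where
  "op_norm X normX normY T = Inf {C. 0 \<le> C \<and> (\<forall>x\<in>X. normY (T x) \<le> C * normX x)}"

definition E2 :: "(real \<Rightarrow> real) \<Rightarrow> real \<Rightarrow> real" where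
  "E2 f = f"

definition E2_quotient :: "real \<Rightarrow> real \<Rightarrow> real \<Rightarrow> (real \<Rightarrow> real) \<Rightarrow> real" where
  "E2_quotient p q t0 f = Lp_norm q {0..t0} (E2 f) / W2D_norm p t0 f"

definition extremal :: "real \<Rightarrow> real \<Rightarrow> real \<Rightarrow> (real \<Rightarrow> real) \<Rightarrow> bool" where
  "extremal p q t0 f \<longleftrightarrow> f \<in> W2D_nonzero p t0 \<and>
     E2_quotient p q t0 f = (SUP g\<in>W2D_nonzero p t0. E2_quotient p q t0 g)"

end

theory Submission
  imports Defs
begin

text \<open>Let \<open>q = p'\<close>. Because the exponents are dual, \<open>E2\<close> factors through the first-order
  embedding of the Dirichlet space into \<open>L\<^sup>q\<close> and its adjoint: integration by parts and Hoelder's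
  inequality bound the energy \<open>\<integral> u'\<^sup>2 = - \<integral> u u''\<close> by the product of the norms of \<open>u\<close> and \<open>u''\<close>,
  so it suffices to bound \<open>\<integral> u'\<^sup>2\<close> from below by the sharp Poincare inequality for the
  norm of \<open>u\<close> in \<open>L\<^sup>q\<close>, with its equality case.

  For the latter, scale \<open>u\<close> so that its maximum modulus is \<open>u m = 1\<close>. With
  \<open>\<phi> x = sqrt (1 - \<bar>x\<bar>\<^sup>q)\<close>, the integrals of \<open>(k u' - \<phi> u)\<^sup>2\<close> over \<open>[0, m]\<close> and of
  \<open>(k u' + \<phi> u)\<^sup>2\<close> over \<open>[m, T]\<close> add up to a quadratic polynomial in \<open>k\<close> whose coefficients depend
  on \<open>u\<close> only through \<open>\<integral> u'\<^sup>2\<close> and \<open>\<integral> \<bar>u\<bar>\<^sup>q\<close>. Optimising over \<open>k\<close> and then over \<open>\<integral> \<bar>u\<bar>\<^sup>q\<close>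
  gives the inequality; equality forces \<open>u' = \<phi> u\<close> and \<open>u' = - \<phi> u\<close> on the two parts, which is the
  differential equation of the generalised sine.\<close>

section \<open>The generalised sine function\<close>

text \<open>Why \<open>k\<close> is free: once the maximum modulus is 1, nothing ties the speed of
  \<open>u\<close> to the length of the interval. Write D for the integral of u'^2, B for that of
  |u|^q, A for the value of B at the sine, and J for the integral of \<phi> over [0, 1]. The optimum
  k = 2 J / D gives (2 J)^2 \<le> (T - B) D, and T = (1 + q/2) A places the maximum of y^(2/q) (T/A
  - y) exactly at y = B/A = 1. The cross terms do not depend on \<open>u\<close>: the integral of
  \<phi>(u) u' sees only end values, so the rise gives J and the fall -J, even if \<open>u\<close>
  is not monotone.

  The obstacle in the equality case is that \<phi> is not Lipschitz at 1, so u' = \<phi>(u) lets a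
  solution rest at the value 1. Counting time excludes this: rise and fall each take T/2, which
  exhausts the interval.

  Hoelder's inequality is sharp at the same function, because S'' = -(q/2) S^(q-1) and (q-1) p = q.

  The space is defined by weak derivatives, so integrating by parts first requires u' to be a
  primitive of u''; the test function machinery serves this.\<close>

text \<open>The substitution t = \<tau>^q carries Euler's integrand for Beta(1/q, 1/2) to this one
  and yields integrability and value at once.\<close>

lemma gen_arcsin_integrand:
  fixes q :: real
  assumes "1 < q"
  shows "(\<lambda>\<tau>. 1 / (1 - \<tau> powr q) powr (1 / 2)) absolutely_integrable_on {0<..<1}" (is ?int)
    and "integral {0<..<1} (\<lambda>\<tau>. 1 / (1 - \<tau> powr q) powr (1 / 2)) = (1 / q) * Beta (1 / q) (1 / 2)" (is ?val)
proof -
  define f where "f = (\<lambda>t::real. (1/q) * (t powr (1 / q - 1) * (1 - t) powr (1 / 2 - 1)))"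
  have "set_integrable lborel {0..1} (\<lambda>t. t powr (1 / q - 1) * (1 - t) powr (1 / 2 - 1))"
    by (rule integrable_Beta) (use assms in auto)
  then have "(\<lambda>t. t powr (1 / q - 1) * (1 - t) powr (1 / 2 - 1)) absolutely_integrable_on {0..1}"
    by (simp add: set_integrable_def integrable_completion borel_measurable_integrable)
  then have "f absolutely_integrable_on {0..1}"
    unfolding f_def by (rule set_integrable_mult_right)
  then have f_int: "f absolutely_integrable_on {0<..<1}"
    by (rule set_integrable_subset) auto
  have "(f has_integral (1/q) * Beta (1/q) (1/2)) {0..1}"
    unfolding f_def by (intro has_integral_mult_right has_integral_Beta_real) (use assms in auto)
  then have f_val: "integral {0<..<1} f = (1/q) * Beta (1/q) (1/2)"
    by (simp add: has_integral_Icc_iff_Ioo integral_unique)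
  have img: "(\<lambda>x. x powr q) ` {0<..<1} = {0<..<1::real}"
  proof (intro equalityI subsetI)
    fix y :: real assume y: "y \<in> {0<..<1}"
    have "y = (y powr (1/q)) powr q" using y assms by (simp add: powr_powr)
    moreover have "y powr (1/q) \<in> {0<..<1}"
      using y assms powr_less_mono2[of "1/q" y 1] by auto
    ultimately show "y \<in> (\<lambda>x. x powr q) ` {0<..<1}" by blast
  next
    fix y :: real assume "y \<in> (\<lambda>x. x powr q) ` {0<..<1}"
    then show "y \<in> {0<..<1}" using assms powr_less_mono2[of q _ 1] by auto
  qed
  have inj: "inj_on (\<lambda>x. x powr q) {0<..<1::real}"
  proof (rule inj_onI)
    fix x y :: real assume "x \<in> {0<..<1}" "y \<in> {0<..<1}" "x powr q = y powr q"
    then show "x = y" using assms powr_less_mono2[of q x y] powr_less_mono2[of q y x]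
      by (cases x y rule: linorder_cases) auto
  qed
  have der: "((\<lambda>x. x powr q) has_field_derivative q * x powr (q - 1)) (at x within {0<..<1})"
    if "x \<in> {0<..<1}" for x :: real
    using that by (auto intro!: derivative_eq_intros)
  \<comment> \<open>The Jacobian q x^(q-1) cancels the factor t^(1/q - 1) of Euler's
    integrand.\<close>
  have eq: "\<bar>q * x powr (q - 1)\<bar> * f (x powr q) = 1 / (1 - x powr q) powr (1 / 2)"
    if x: "x \<in> {0<..<1}" for x :: real
  proof -
    have "x powr (q - 1) * (x powr q) powr (1 / q - 1) = 1"
      using x assms by (simp add: powr_powr flip: powr_add) (simp add: field_simps)
    then show ?thesis
      using assms x by (simp add: f_def abs_mult powr_minus field_simps)
  qed
  have cv: "(\<lambda>x. \<bar>q * x powr (q - 1)\<bar> * f (x powr q)) absolutely_integrable_on {0<..<1} \<and>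
     integral {0<..<1} (\<lambda>x. \<bar>q * x powr (q - 1)\<bar> * f (x powr q)) = (1/q) * Beta (1/q) (1/2)"
    using has_absolute_integral_change_of_variables_1'[OF _ der inj, of f "(1/q) * Beta (1/q) (1/2)"]
      f_int f_val img by simp
  show ?int
    using conjunct1[OF cv] by (rule absolutely_integrable_spike[of _ _ "{}"]) (use eq in auto)
  have "integral {0<..<1} (\<lambda>x. \<bar>q * x powr (q - 1)\<bar> * f (x powr q)) =
      integral {0<..<1} (\<lambda>\<tau>. 1 / (1 - \<tau> powr q) powr (1 / 2))"
    by (rule integral_cong) (rule eq)
  then show ?val
    using conjunct2[OF cv] by simp
qed

section \<open>Two tools from calculus: exceptional points of a derivative, vanishing square
  integrals\<close>

text \<open>By the fundamental theorem \<open>f\<close> is a primitive of the continuous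
  \<open>f'\<close>, hence differentiable at the exceptional points as well. This is for the
  midpoint \<open>T/2\<close>, where the inverse function rule breaks down because \<phi> vanishes,
  and for the end points.\<close>

lemma has_derivative_off_finite:
  fixes f f' :: "real \<Rightarrow> real"
  assumes fin: "finite K" and f: "continuous_on {a..b} f" and f': "continuous_on {a..b} f'"
    and der: "\<And>x. x \<in> {a<..<b} - K \<Longrightarrow> (f has_real_derivative f' x) (at x)"
    and t: "t \<in> {a..b}"
  shows "(f has_real_derivative f' t) (at t within {a..b})"
proof -
  have eq: "f a + integral {a..x} f' = f x" if x: "x \<in> {a..b}" for x
  proof -
    have "(f' has_integral f x - f a) {a..x}"
      using x by (intro fundamental_theorem_of_calculus_interior_strong[OF fin])
        (auto intro!: der continuous_on_subset[OF f] simp flip: has_real_derivative_iff_has_vector_derivative)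
    then show ?thesis by (simp add: integral_unique)
  qed
  have "((\<lambda>x. f a + integral {a..x} f') has_real_derivative f' t) (at t within {a..b})"
    using integral_has_real_derivative[OF f' t] by (auto intro!: derivative_eq_intros)
  then show ?thesis
    by (rule has_field_derivative_transform_within[where d = 1]) (use t eq in auto)
qed

text \<open>If the square is not integrable, its integral is 0 by convention.\<close>

lemma integral_square_nonneg: "0 \<le> integral X (\<lambda>t. (f t)\<^sup>2)" for f :: "real \<Rightarrow> real"
  by (metis integral_nonneg not_integrable_integral order_refl zero_le_power2)

lemma continuous_zero_if_integral_square_zero:
  fixes f :: "real \<Rightarrow> real"
  assumes f: "continuous_on {a..b} f" and I: "integral {a..b} (\<lambda>t. (f t)\<^sup>2) = 0" and t: "t \<in> {a..b}" and "a < b"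
  shows "f t = 0"
proof -
  have "((\<lambda>t. (f t)\<^sup>2) has_integral 0) {a..b}"
    using I by (metis continuous_on_power f integrable_continuous_interval integrable_integral)
  then have "(f t)\<^sup>2 = 0"
    using t \<open>a < b\<close> f by (intro has_integral_0_cbox_imp_0[of a b "\<lambda>t. (f t)\<^sup>2"]) (auto intro!: continuous_intros)
  then show ?thesis by simp
qed

locale gen_sine =
  fixes q :: real
  assumes q: "1 < q"
begin

abbreviation T :: real where "T \<equiv> gen_pi 2 q"
abbreviation F :: "real \<Rightarrow> real" where "F \<equiv> gen_arcsin 2 q"
abbreviation S :: "real \<Rightarrow> real" where "S \<equiv> gen_sin 2 q"

definition w :: "real \<Rightarrow> real" where "w \<tau> = 1 / (1 - \<tau> powr q) powr (1 / 2)"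

text \<open>The speed of the sine as a function of its value: S' = \<phi>(S) on the way up. The
  modulus makes it even, since competitors in the Poincare inequality may take negative
  values.\<close>

definition \<phi> :: "real \<Rightarrow> real" where "\<phi> x = sqrt (1 - \<bar>x\<bar> powr q)"

lemma powr_lt_1: "0 \<le> x \<Longrightarrow> x < 1 \<Longrightarrow> x powr q < 1" for x :: real
  using powr_less_mono2[of q x 1] q by auto

lemma powr_le_1: "\<bar>x\<bar> \<le> 1 \<Longrightarrow> \<bar>x\<bar> powr q \<le> 1" for x :: real
  using powr_mono2[of q "\<bar>x\<bar>" 1] q by auto

lemma w_eq: "0 \<le> x \<Longrightarrow> x < 1 \<Longrightarrow> w x = 1 / \<phi> x"
  using powr_lt_1[of x] by (simp add: w_def \<phi>_def powr_half_sqrt)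

lemma \<phi>_pos: "0 \<le> x \<Longrightarrow> x < 1 \<Longrightarrow> 0 < \<phi> x"
  using powr_lt_1[of x] by (simp add: \<phi>_def)

lemma \<phi>_nonneg: "\<bar>x\<bar> \<le> 1 \<Longrightarrow> 0 \<le> \<phi> x"
  using powr_le_1[of x] by (simp add: \<phi>_def)

lemma \<phi>_simps [simp]: "\<phi> 1 = 0" "\<phi> 0 = 1" "\<phi> (- x) = \<phi> x"
  using q by (auto simp: \<phi>_def)

lemma \<phi>_sq: "\<bar>x\<bar> \<le> 1 \<Longrightarrow> (\<phi> x)\<^sup>2 = 1 - \<bar>x\<bar> powr q"
  using powr_le_1[of x] by (simp add: \<phi>_def)

lemma continuous_on_\<phi>: "continuous_on A \<phi>"
  unfolding \<phi>_def by (intro continuous_intros continuous_on_powr') (use q in auto)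

lemma w_integrable: "w absolutely_integrable_on {0..1}"
proof -
  have "w absolutely_integrable_on {0<..<1}"
    using gen_arcsin_integrand(1)[OF q] unfolding w_def .
  then show ?thesis
    by (rule absolutely_integrable_spike_set) (auto intro: negligible_subset[of "{0,1}"])
qed

lemma w_integrable_sub: "0 \<le> y \<Longrightarrow> y \<le> 1 \<Longrightarrow> w absolutely_integrable_on {0..y}"
  by (rule set_integrable_subset[OF w_integrable]) auto

lemma borel_measurable_w [measurable]: "w \<in> borel_measurable borel"
  unfolding w_def by measurable

lemma F_eq: "0 \<le> y \<Longrightarrow> y \<le> 1 \<Longrightarrow> F y = integral {0..y} w"
  using set_lebesgue_integral_eq_integral(2)[OF w_integrable_sub[of y]]
  by (simp add: gen_arcsin_def set_lebesgue_integral_def integral_completion flip: w_def)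

lemma F_0 [simp]: "F 0 = 0"
  by (simp add: F_eq)

lemma F_1: "F 1 = T / 2"
  by (simp add: gen_arcsin_def gen_pi_def)

lemma T_eq_Beta: "T = (2 / q) * Beta (1 / q) (1 / 2)"
proof -
  have "F 1 = integral {0<..<1} w"
    by (simp add: F_eq integral_open_interval_real)
  then show ?thesis
    using gen_arcsin_integrand(2)[OF q] F_1 by (simp add: w_def[abs_def])
qed

lemma continuous_on_F: "continuous_on {0..1} F"
proof -
  have "continuous_on {0..1} (\<lambda>y. integral {0..y} w)"
    by (rule indefinite_integral_continuous_1) (use w_integrable absolutely_integrable_on_def in blast)
  then show ?thesis
    by (rule continuous_on_eq) (auto simp: F_eq)
qed

text \<open>The bound \<open>b\<close> keeps away from the singularity of the integrand at 1. The
  one-sided form includes y = 0, where every competitor starts.\<close>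

lemma F_deriv:
  assumes "0 \<le> y" "y < b" "b < 1"
  shows "(F has_real_derivative 1 / \<phi> y) (at y within {0..b})"
proof -
  have "continuous_on {0..b} (\<lambda>x. 1 / \<phi> x)"
    using \<phi>_pos assms by (intro continuous_intros continuous_on_\<phi>) (auto simp: less_le)
  then have "continuous_on {0..b} w"
    by (rule continuous_on_eq) (use assms w_eq in auto)
  then have "((\<lambda>y. integral {0..y} w) has_real_derivative w y) (at y within {0..b})"
    by (rule integral_has_real_derivative) (use assms in auto)
  moreover have "w y = 1 / \<phi> y" using w_eq assms by auto
  ultimately have "((\<lambda>y. integral {0..y} w) has_real_derivative 1 / \<phi> y) (at y within {0..b})"
    by simp
  then show ?thesis
    by (rule has_field_derivative_transform_within[where d = 1]) (use assms in \<open>auto simp: F_eq\<close>)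
qed

lemma F_deriv_at:
  assumes "0 < y" "y < 1"
  shows "(F has_real_derivative 1 / \<phi> y) (at y)"
proof -
  obtain b where b: "y < b" "b < 1" using dense assms(2) by blast
  show ?thesis
    using F_deriv[of y b] at_within_Icc_at[of 0 y b] assms b by simp
qed

lemma F_strict_mono:
  assumes "0 \<le> x" "x < y" "y \<le> 1"
  shows "F x < F y"
proof (rule DERIV_pos_imp_increasing_open[OF assms(2)])
  show "\<exists>d. (F has_real_derivative d) (at z) \<and> 0 < d" if "x < z" "z < y" for z
    using F_deriv_at[of z] \<phi>_pos[of z] that assms by (intro exI[of _ "1 / \<phi> z"]) auto
  show "continuous_on {x..y} F"
    by (rule continuous_on_subset[OF continuous_on_F]) (use assms in auto)
qed

lemma T_pos: "0 < T"
  using F_strict_mono[of 0 1] by (simp add: F_1)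

lemma F_inj: "inj_on F {0..1}"
  by (rule linorder_inj_onI) (use F_strict_mono in fastforce)+

lemma F_image: "F ` {0..1} = {0..T/2}"
proof -
  have "F ` {0..1} = {F 0..F 1}"
  proof (intro equalityI subsetI)
    fix t assume "t \<in> F ` {0..1}"
    then show "t \<in> {F 0..F 1}" using F_strict_mono by (force simp: less_le)
  next
    fix t assume "t \<in> {F 0..F 1}"
    then show "t \<in> F ` {0..1}" using IVT'[of F 0 t 1] continuous_on_F by force
  qed
  then show ?thesis by (simp add: F_1)
qed

section \<open>Existence and uniqueness of the generalised sine\<close>

definition S0 :: "real \<Rightarrow> real" where "S0 = inv_into {0..1} F"

lemma S0_F: "y \<in> {0..1} \<Longrightarrow> S0 (F y) = y"
  unfolding S0_def by (rule inv_into_f_f[OF F_inj])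

lemma F_S0: "t \<in> {0..T/2} \<Longrightarrow> F (S0 t) = t"
  unfolding S0_def by (rule f_inv_into_f) (simp add: F_image)

lemma S0_range: "t \<in> {0..T/2} \<Longrightarrow> S0 t \<in> {0..1}"
  unfolding S0_def by (metis F_image inv_into_into)

lemma continuous_on_S0: "continuous_on {0..T/2} S0"
  using continuous_on_inv[OF continuous_on_F compact_Icc, of S0] S0_F F_image by auto

text \<open>Composing with \<open>sin\<close> and \<open>arcsin\<close> performs the reflections and the periodic
  continuation in one stroke.\<close>

definition S1 :: "real \<Rightarrow> real" where
  "S1 x = sgn (sin (pi * x / T)) * S0 (T / pi * arcsin \<bar>sin (pi * x / T)\<bar>)"

lemma S1_arg: "T / pi * arcsin \<bar>sin z\<bar> \<in> {0..T/2}"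
proof -
  have "0 \<le> arcsin \<bar>sin z\<bar>" using arcsin_le_arcsin[of 0 "\<bar>sin z\<bar>"] by simp
  moreover have "arcsin \<bar>sin z\<bar> \<le> pi / 2" by (rule arcsin_ubound) (auto simp: abs_le_iff)
  ultimately show ?thesis using T_pos by (auto simp: field_simps)
qed

text \<open>The description under \<open>THE\<close> in \<open>gen_sin\<close>, specialised to r =
  2; \<open>S1\<close> is a witness for it.\<close>

abbreviation sine_spec :: "(real \<Rightarrow> real) \<Rightarrow> bool" where
  "sine_spec f \<equiv>
     (\<forall>x. f x \<in> {-1..1}) \<and>
     (\<forall>x. f (x + 2 * T) = f x) \<and>
     (\<forall>x. f (- x) = - f x) \<and>
     (\<forall>x. f (T / 2 + x) = f (T / 2 - x)) \<and>
     (\<forall>y\<in>{0..1}. f (F y) = y)"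

lemma S1_spec: "sine_spec S1"
proof (intro conjI allI ballI)
  fix x
  have "S0 (T / pi * arcsin \<bar>sin (pi * x / T)\<bar>) \<in> {0..1}"
    using S0_range S1_arg by blast
  then show "S1 x \<in> {-1..1}"
    by (auto simp: S1_def sgn_if)
  have "pi * (x + 2 * T) / T = pi * x / T + 2 * pi"
    using T_pos by (simp add: field_simps)
  then show "S1 (x + 2 * T) = S1 x"
    by (simp add: S1_def)
  show "S1 (- x) = - S1 x"
    by (simp add: S1_def sgn_minus)
  have "pi * (T / 2 + x) / T = pi / 2 + pi * x / T" "pi * (T / 2 - x) / T = pi / 2 - pi * x / T"
    using T_pos by (simp_all add: field_simps)
  then show "S1 (T / 2 + x) = S1 (T / 2 - x)"
    by (simp add: S1_def sin_add sin_diff)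
next
  fix y :: real assume y: "y \<in> {0..1}"
  define z where "z = pi * F y / T"
  have Fy: "F y \<in> {0..T/2}" using y F_image by blast
  then have z: "0 \<le> z" "z \<le> pi / 2" using T_pos by (auto simp: z_def field_simps)
  then have "sin z \<ge> 0" by (intro sin_ge_zero) auto
  moreover have "T / pi * arcsin (sin z) = F y"
    using z T_pos by (subst arcsin_sin) (auto simp: z_def)
  ultimately have *: "S1 (F y) = sgn (sin z) * y"
    using S0_F[OF y] by (simp add: S1_def flip: z_def)
  \<comment> \<open>The factor \<open>sgn (sin z)\<close> is 1 for positive \<open>y\<close>; at
    \<open>y = 0\<close> the product is 0 in any case.\<close>
  show "S1 (F y) = y"
  proof (cases "y = 0")
    case False
    then have "0 < F y" using F_strict_mono[of 0 y] y by auto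
    then have "0 < z" using T_pos by (simp add: z_def)
    then have "0 < sin z" using z by (intro sin_gt_zero) (auto simp: pi_half_less_two intro: le_less_trans)
    then show ?thesis using * by simp
  qed (use * in simp)
qed

lemma reflect_eq:
  assumes "\<forall>x. f (T / 2 + x) = f (T / 2 - x)"
  shows "f (T - t) = f t"
  using spec[OF assms, of "T / 2 - t"] by simp

text \<open>Values on [0, T/2] are forced because \<open>F\<close> is onto that interval;
  reflection, oddness and periodicity carry the agreement to [0, T], [-T, T] and the line.\<close>

lemma sine_spec_unique:
  assumes f: "sine_spec f" and g: "sine_spec g"
  shows "f = g"
proof
  fix x
  have 1: "f t = g t" if "t \<in> {0..T/2}" for t
    using that f g F_image by (metis imageE)
  have 2: "f t = g t" if "t \<in> {0..T}" for t
  proof (cases "t \<le> T/2")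
    case False
    have "f t = f (T - t)" "g t = g (T - t)"
      using f g reflect_eq by metis+
    then show ?thesis using 1[of "T - t"] that False by auto
  qed (use 1 that in auto)
  have 3: "f t = g t" if "t \<in> {-T..T}" for t
  proof (cases "t \<ge> 0")
    case False
    have "f t = - f (- t)" "g t = - g (- t)" using f g by simp_all
    then show ?thesis using 2[of "- t"] that False by auto
  qed (use 2 that in auto)
  have per: "h (y + of_int k * (2 * T)) = h y" if h: "\<forall>x. h (x + 2 * T) = h x" for h :: "real \<Rightarrow> real" and y k
  proof (induction k rule: int_induct[of _ 0])
    case (step1 i)
    have "h (y + of_int (i + 1) * (2 * T)) = h ((y + of_int i * (2 * T)) + 2 * T)"
      by (simp add: algebra_simps)
    then show ?case using h step1 by simp
  next
    case (step2 i)
    have "h (y + of_int i * (2 * T)) = h ((y + of_int (i - 1) * (2 * T)) + 2 * T)"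
      by (simp add: algebra_simps)
    then show ?case using h step2 by simp
  qed simp
  \<comment> \<open>The number of periods that moves \<open>x\<close> into [-T, T).\<close>
  define k where "k = \<lfloor>(x + T) / (2 * T)\<rfloor>"
  define y where "y = x - of_int k * (2 * T)"
  have "of_int k \<le> (x + T) / (2 * T)" "(x + T) / (2 * T) < of_int k + 1"
    unfolding k_def by linarith+
  then have "of_int k * (2 * T) \<le> x + T" "x + T < (of_int k + 1) * (2 * T)"
    using T_pos by (simp_all add: field_simps)
  then have "y \<in> {-T..T}" by (auto simp: y_def algebra_simps)
  then have "f y = g y" by (rule 3)
  moreover have "x = y + of_int k * (2 * T)" by (simp add: y_def)
  ultimately show "f x = g x" using per[of f y k] per[of g y k] f g by metis
qed

lemma S_spec: "sine_spec S"
  unfolding gen_sin_def by (rule theI2[of _ S1]) (use S1_spec sine_spec_unique in blast)+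

lemma S_F: "y \<in> {0..1} \<Longrightarrow> S (F y) = y"
  using S_spec by blast

lemma S_eq_S0: "t \<in> {0..T/2} \<Longrightarrow> S t = S0 t"
  using F_S0 S0_range S_F by metis

lemma F_S: "t \<in> {0..T/2} \<Longrightarrow> F (S t) = t"
  using F_S0 S_eq_S0 by simp

lemma S_reflect: "S (T - t) = S t"
  using S_spec reflect_eq by blast

lemma S_0 [simp]: "S 0 = 0" and S_half [simp]: "S (T/2) = 1" and S_T [simp]: "S T = 0"
  using S_F[of 0] S_F[of 1] S_reflect[of 0] by (auto simp: F_1)

lemma S_range: "t \<in> {0..T} \<Longrightarrow> S t \<in> {0..1}"
  using S_eq_S0[of t] S0_range[of t] S_eq_S0[of "T - t"] S0_range[of "T - t"] S_reflect[of t]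
  by (cases "t \<le> T/2") auto

lemma S_less_1: "t \<in> {0..T} \<Longrightarrow> t \<noteq> T/2 \<Longrightarrow> S t < 1"
  using F_S[of t] F_S[of "T - t"] S_reflect[of t] S_range[of t] F_1
  by (cases "t \<le> T/2") (force simp: less_le)+

lemma S_pos: "t \<in> {0<..<T} \<Longrightarrow> 0 < S t"
  using F_S[of t] F_S[of "T - t"] S_reflect[of t] S_range[of t] F_0
  by (cases "t \<le> T/2") (force simp: less_le)+

section \<open>The differential equation of the sine on [0, T]\<close>

lemma continuous_on_S: "continuous_on {0..T} S"
proof -
  have 1: "continuous_on {0..T/2} S"
    using continuous_on_S0 by (rule continuous_on_eq) (simp add: S_eq_S0)
  have "continuous_on {T/2..T} (\<lambda>t. S (T - t))"
    by (rule continuous_on_compose2[OF 1]) (auto intro!: continuous_intros)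
  then have "continuous_on {T/2..T} S" by (simp add: S_reflect)
  with 1 have "continuous_on ({0..T/2} \<union> {T/2..T}) S"
    by (intro continuous_on_closed_Un) auto
  moreover have "{0..T/2} \<union> {T/2..T} = {0..T}" using T_pos by auto
  ultimately show ?thesis by simp
qed

lemma S_deriv_left:
  assumes t: "t \<in> {0<..<T/2}"
  shows "(S has_real_derivative \<phi> (S t)) (at t)"
proof -
  have St: "0 < S t" "S t < 1" using S_pos[of t] S_less_1[of t] t T_pos by auto
  have "(S has_real_derivative inverse (1 / \<phi> (S t))) (at t)"
  proof (rule DERIV_inverse_function[where f = F and a = 0 and b = "T/2"])
    show "(F has_real_derivative 1 / \<phi> (S t)) (at (S t))" using F_deriv_at St by blast
    show "1 / \<phi> (S t) \<noteq> 0" using \<phi>_pos[of "S t"] St by auto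
    show "isCont S t"
      using continuous_on_interior[OF continuous_on_S] t T_pos by (auto simp: interior_atLeastAtMost_real)
  qed (use t F_S in auto)
  then show ?thesis by simp
qed

lemma S_deriv_right:
  assumes t: "t \<in> {T/2<..<T}"
  shows "(S has_real_derivative - \<phi> (S t)) (at t)"
proof -
  have "((\<lambda>t. S (T - t)) has_real_derivative \<phi> (S (T - t)) * (-1)) (at t)"
    by (rule DERIV_chain2[where f = S]) (use S_deriv_left[of "T - t"] t in \<open>auto intro!: derivative_eq_intros\<close>)
  then show ?thesis by (simp add: S_reflect)
qed

text \<open>The derivative of \<open>S\<close>, a generalised cosine; its sign changes at the
  midpoint, where \<phi>(S) is 0.\<close>

definition C :: "real \<Rightarrow> real" where
  "C t = (if t \<le> T/2 then \<phi> (S t) else - \<phi> (S t))"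

text \<open>The second derivative of \<open>S\<close>, found by differentiating C^2 = 1 - S^q and
  dividing by 2 C.\<close>

definition R :: "real \<Rightarrow> real" where
  "R t = - (q / 2) * \<bar>S t\<bar> powr (q - 1)"

lemma continuous_on_C: "continuous_on {0..T} C"
proof -
  have half: "\<phi> (S t) = 0" if "T = t * 2" for t
    using S_half that by simp
  have "continuous_on ({0..T/2} \<union> {T/2..T}) (\<lambda>t. if t \<le> T/2 then \<phi> (S t) else - \<phi> (S t))"
    using T_pos
    by (intro continuous_on_cases continuous_intros continuous_on_compose2[OF continuous_on_\<phi>[of UNIV]]
        continuous_on_subset[OF continuous_on_S])
       (auto dest: half)
  moreover have "{0..T/2} \<union> {T/2..T} = {0..T}" using T_pos by auto
  ultimately show ?thesis unfolding C_def[abs_def] by simp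
qed

lemma continuous_on_R: "continuous_on {0..T} R"
  unfolding R_def[abs_def]
  by (intro continuous_intros continuous_on_powr' continuous_on_S) (use q in auto)

lemma C_sq: "t \<in> {0..T} \<Longrightarrow> (C t)\<^sup>2 = 1 - \<bar>S t\<bar> powr q"
  using \<phi>_sq[of "S t"] S_range[of t] by (auto simp: C_def)

lemma S_deriv_at:
  assumes "t \<in> {0<..<T}" "t \<noteq> T/2"
  shows "(S has_real_derivative C t) (at t)"
  using S_deriv_left[of t] S_deriv_right[of t] assms by (cases "t \<le> T/2") (auto simp: C_def)

lemma C_deriv_at:
  assumes t: "t \<in> {0<..<T}" "t \<noteq> T/2"
  shows "(C has_real_derivative R t) (at t)"
proof -
  have St: "0 < S t" "S t < 1" using S_pos S_less_1 t by auto
  have pos: "0 < 1 - S t powr q" using powr_lt_1[of "S t"] St by auto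
  \<comment> \<open>The sign of \<open>C\<close> is locally constant off the midpoint, so it may be
    treated as a constant factor.\<close>
  define s :: real where "s = (if t \<le> T/2 then 1 else -1)"
  have 1: "((\<lambda>x. s * sqrt (1 - S x powr q)) has_real_derivative
     s * ((- (q * S t powr (q - 1) * C t)) * (inverse (sqrt (1 - S t powr q)) / 2))) (at t)"
    using S_deriv_at[OF t] St pos
    by (auto intro!: derivative_eq_intros simp: field_simps)
  have ev: "eventually (\<lambda>x. C x = s * sqrt (1 - S x powr q)) (nhds t)"
  proof (rule eventually_nhds_in_open[THEN eventually_mono])
    show "open (if t \<le> T/2 then {0<..<T/2} else {T/2<..<T})" by auto
    show "t \<in> (if t \<le> T/2 then {0<..<T/2} else {T/2<..<T})" using t by auto
    fix x assume "x \<in> (if t \<le> T/2 then {0<..<T/2} else {T/2<..<T})"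
    then show "C x = s * sqrt (1 - S x powr q)"
      using S_pos[of x] T_pos by (auto simp: C_def s_def \<phi>_def split: if_splits)
  qed
  have "C t = s * sqrt (1 - S t powr q)" using eventually_nhds_x_imp_x[OF ev] .
  \<comment> \<open>The square root cancels against \<open>C t\<close>, and s * s = 1.\<close>
  then have "s * ((- (q * S t powr (q - 1) * C t)) * (inverse (sqrt (1 - S t powr q)) / 2)) = R t"
    using pos St by (auto simp: R_def s_def field_simps)
  with 1 show ?thesis using DERIV_cong_ev[OF refl ev refl] by auto
qed

lemma S_deriv: "t \<in> {0..T} \<Longrightarrow> (S has_real_derivative C t) (at t within {0..T})"
  by (rule has_derivative_off_finite[of "{T/2}"])
     (auto simp: continuous_on_S continuous_on_C intro: S_deriv_at)

lemma C_deriv: "t \<in> {0..T} \<Longrightarrow> (C has_real_derivative R t) (at t within {0..T})"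
  by (rule has_derivative_off_finite[of "{T/2}"])
     (auto simp: continuous_on_R continuous_on_C intro: C_deriv_at)

section \<open>The constants of the sine, all expressed through \<open>A\<close>\<close>

definition A :: real where "A = integral {0..T} (\<lambda>t. \<bar>S t\<bar> powr q)"

text \<open>Integrate (C S)' = C^2 + R S, where R S = -(q/2) S^q and \<open>S\<close> vanishes at
  both ends.\<close>

lemma integral_C_sq: "((\<lambda>t. (C t)\<^sup>2) has_integral q / 2 * A) {0..T}"
proof -
  have cont: "continuous_on {0..T} (\<lambda>t. \<bar>S t\<bar> powr q)"
    by (intro continuous_intros continuous_on_powr' continuous_on_S) (use q in auto)
  have SA: "((\<lambda>t. \<bar>S t\<bar> powr q) has_integral A) {0..T}"
    unfolding A_def by (rule integrable_integral[OF integrable_continuous_interval[OF cont]])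
  have "((\<lambda>t. C t * C t + R t * S t) has_integral C T * S T - C 0 * S 0) {0..T}"
    using T_pos
    by (intro fundamental_theorem_of_calculus)
       (auto intro!: derivative_eq_intros C_deriv S_deriv
             simp flip: has_real_derivative_iff_has_vector_derivative)
  then have "((\<lambda>t. C t * C t + R t * S t) has_integral 0) {0..T}"
    by simp
  from has_integral_add[OF this has_integral_mult_right[OF SA, of "q/2"]]
  have "((\<lambda>t. C t * C t + R t * S t + q / 2 * \<bar>S t\<bar> powr q) has_integral q / 2 * A) {0..T}"
    by simp
  then show ?thesis
  proof (rule has_integral_eq[rotated])
    fix t assume "t \<in> {0..T}"
    then have "S t \<ge> 0" using S_range by auto
    then have "\<bar>S t\<bar> powr (q - 1) * S t = \<bar>S t\<bar> powr q"
      by (cases "S t = 0") (auto simp: powr_diff)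
    then show "C t * C t + R t * S t + q / 2 * \<bar>S t\<bar> powr q = (C t)\<^sup>2"
      by (simp add: R_def power2_eq_square)
  qed
qed

text \<open>Integrate the Pythagorean identity C^2 + S^q = 1.\<close>

lemma T_eq_A: "T = (1 + q / 2) * A"
proof -
  have cont: "continuous_on {0..T} (\<lambda>t. \<bar>S t\<bar> powr q)"
    by (intro continuous_intros continuous_on_powr' continuous_on_S) (use q in auto)
  have SA: "((\<lambda>t. \<bar>S t\<bar> powr q) has_integral A) {0..T}"
    unfolding A_def by (rule integrable_integral[OF integrable_continuous_interval[OF cont]])
  from has_integral_add[OF integral_C_sq SA]
  have "((\<lambda>t. 1) has_integral q / 2 * A + A) {0..T}"
    by (rule has_integral_eq[rotated]) (use C_sq in auto)
  moreover have "((\<lambda>t. 1) has_integral T) {0..T}"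
    using has_integral_const_real[of "1::real" 0 T] T_pos by simp
  ultimately show ?thesis using has_integral_unique by (auto simp: algebra_simps)
qed

lemma A_pos: "0 < A"
  using T_eq_A T_pos q by (simp add: zero_less_mult_iff)

lemma A_eq_Beta: "A = (2 / q) * Beta (1 / 2) ((q + 1) / q)"
proof -
  have "(q + 1) / q = 1 / q + 1" using q by (simp add: field_simps)
  \<comment> \<open>The recursion (x + y) Beta(x + 1, y) = x Beta(x, y) links the Beta value in
    \<open>T\<close> to the one in the theorem.\<close>
  moreover have "(1/q + 1/2) * Beta (1/q + 1) (1/2) = (1/q) * Beta (1/q) (1/2)"
  proof (rule Beta_plus1_left)
    have "0 < 1 / q" using q by simp
    then show "1 / q \<notin> \<int>\<^sub>\<le>\<^sub>0" by (auto elim!: nonpos_Ints_cases simp del: zero_less_divide_1_iff)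
  qed
  ultimately have "(1/q + 1/2) * Beta ((q + 1) / q) (1/2) = (1/q) * Beta (1/q) (1/2)"
    by simp
  moreover have "1/q + 1/2 = (1 + q / 2) / q" using q by (simp add: field_simps)
  ultimately have "Beta (1/q) (1/2) = (1 + q / 2) * Beta ((q + 1) / q) (1/2)"
    using q by simp
  then have "(1 + q / 2) * A = (1 + q / 2) * ((2 / q) * Beta ((q + 1) / q) (1 / 2))"
    using T_eq_A T_eq_Beta by simp
  then have "A = (2 / q) * Beta ((q + 1) / q) (1 / 2)"
    using q by (subst (asm) mult_cancel_left) auto
  then show ?thesis
    by (simp only: Beta_commute[of "1/2"])
qed

subsection \<open>The sharp Poincare inequality\<close>

text \<open>The value of the integral of \<phi>(u) u' along any path of \<open>u\<close> from 0 to
  1.\<close>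

definition J :: real where "J = integral {0..1} \<phi>"

text \<open>Expand the squares: the cross terms are path independent, and \<phi>(u)^2 = 1 -
  |u|^q.\<close>

lemma defect_identity:
  assumes u: "\<And>t. t \<in> {0..T} \<Longrightarrow> (u has_real_derivative v t) (at t within {0..T})"
    and v: "continuous_on {0..T} v"
    and bc: "u 0 = 0" "u T = 0" and le1: "\<And>t. t \<in> {0..T} \<Longrightarrow> \<bar>u t\<bar> \<le> 1"
    and m: "m \<in> {0..T}" "u m = 1"
  shows "integral {0..m} (\<lambda>t. (k * v t - \<phi> (u t))\<^sup>2) + integral {m..T} (\<lambda>t. (k * v t + \<phi> (u t))\<^sup>2) =
     k\<^sup>2 * integral {0..T} (\<lambda>t. (v t)\<^sup>2) - 4 * k * J + (T - integral {0..T} (\<lambda>t. \<bar>u t\<bar> powr q))"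
proof -
  have cu: "continuous_on {0..T} u" using u by (rule DERIV_continuous_on)
  have cphi: "continuous_on {0..T} (\<lambda>t. \<phi> (u t))"
    by (rule continuous_on_compose2[OF continuous_on_\<phi>[of UNIV] cu]) auto
  have pow: "(\<lambda>t. \<bar>u t\<bar> powr q) integrable_on {0..T}"
    by (intro integrable_continuous_interval continuous_intros continuous_on_powr' cu) (use q in auto)
  have v2: "(\<lambda>t. (v t)\<^sup>2) integrable_on {0..T}"
    by (intro integrable_continuous_interval continuous_intros v)
  have p2: "(\<lambda>t. (\<phi> (u t))\<^sup>2) integrable_on {0..T}"
    by (intro integrable_continuous_interval continuous_intros cphi)
  \<comment> \<open>The difference is the oriented integral from \<open>u a\<close> to
    \<open>u b\<close>; this form of substitution requires no monotonicity of
    \<open>u\<close>.\<close>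
  have *: "((\<lambda>t. v t *\<^sub>R \<phi> (u t)) has_integral (integral {u a..u b} \<phi> - integral {u b..u a} \<phi>)) {a..b}"
    if "0 \<le> a" "a \<le> b" "b \<le> T" for a b
  proof (rule has_integral_substitution_general[where s = "{}" and c = "-1" and d = 1])
    show "u ` {a..b} \<subseteq> {- 1..1}" using le1 that by (fastforce simp: abs_le_iff)
    show "continuous_on {- 1..1} \<phi>" by (rule continuous_on_\<phi>)
    show "continuous_on {a..b} u" by (rule continuous_on_subset[OF cu]) (use that in auto)
    show "(u has_real_derivative v x) (at x within {a..b})" if "x \<in> {a..b} - {}" for x
      by (rule DERIV_subset[OF u]) (use that \<open>0 \<le> a\<close> \<open>b \<le> T\<close> in auto)
  qed (use that in auto)
  have sub: "f integrable_on {0..m}" "f integrable_on {m..T}" if "f integrable_on {0..T}" for f :: "real \<Rightarrow> real"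
    using that m by (auto intro: integrable_on_subinterval)
  have left: "((\<lambda>t. k\<^sup>2 * (v t)\<^sup>2 - 2 * k * (v t * \<phi> (u t)) + (\<phi> (u t))\<^sup>2) has_integral
     k\<^sup>2 * integral {0..m} (\<lambda>t. (v t)\<^sup>2) - 2 * k * J + integral {0..m} (\<lambda>t. (\<phi> (u t))\<^sup>2)) {0..m}"
    using *[of 0 m] m bc sub v2 p2
    by (intro has_integral_add has_integral_diff has_integral_mult_right integrable_integral) (auto simp: J_def)
  have right: "((\<lambda>t. k\<^sup>2 * (v t)\<^sup>2 + 2 * k * (v t * \<phi> (u t)) + (\<phi> (u t))\<^sup>2) has_integral
     k\<^sup>2 * integral {m..T} (\<lambda>t. (v t)\<^sup>2) + 2 * k * (- J) + integral {m..T} (\<lambda>t. (\<phi> (u t))\<^sup>2)) {m..T}"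
    using *[of m T] m bc sub v2 p2
    by (intro has_integral_add has_integral_mult_right integrable_integral) (auto simp: J_def)
  have c: "integral {0..m} f + integral {m..T} f = integral {0..T} f" if "f integrable_on {0..T}" for f :: "real \<Rightarrow> real"
    using Henstock_Kurzweil_Integration.integral_combine[OF _ _ that, of m] m by simp
  have "integral {0..T} (\<lambda>t. (\<phi> (u t))\<^sup>2) = integral {0..T} (\<lambda>t. 1 - \<bar>u t\<bar> powr q)"
    by (rule integral_cong) (use \<phi>_sq le1 in blast)
  also have "\<dots> = T - integral {0..T} (\<lambda>t. \<bar>u t\<bar> powr q)"
    using T_pos by (subst integral_diff[OF _ pow]) auto
  finally have p: "integral {0..T} (\<lambda>t. (\<phi> (u t))\<^sup>2) = T - integral {0..T} (\<lambda>t. \<bar>u t\<bar> powr q)" .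
  have "(\<lambda>t. (k * v t - \<phi> (u t))\<^sup>2) = (\<lambda>t. k\<^sup>2 * (v t)\<^sup>2 - 2 * k * (v t * \<phi> (u t)) + (\<phi> (u t))\<^sup>2)"
    "(\<lambda>t. (k * v t + \<phi> (u t))\<^sup>2) = (\<lambda>t. k\<^sup>2 * (v t)\<^sup>2 + 2 * k * (v t * \<phi> (u t)) + (\<phi> (u t))\<^sup>2)"
    by (auto simp: power2_eq_square algebra_simps)
  moreover have "k\<^sup>2 * integral {0..T} (\<lambda>t. (v t)\<^sup>2) =
      k\<^sup>2 * integral {0..m} (\<lambda>t. (v t)\<^sup>2) + k\<^sup>2 * integral {m..T} (\<lambda>t. (v t)\<^sup>2)"
    unfolding c[OF v2, symmetric] by (rule distrib_left)
  ultimately show ?thesis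
    using integral_unique[OF left] integral_unique[OF right] c[OF p2] p
    by simp
qed

text \<open>For the sine itself with k = 1 both defects vanish, so the identity can be solved for
  \<open>J\<close>.\<close>

lemma J_eq: "J = q / 4 * A"
proof -
  have half: "\<phi> (S t) = 0" if "T / 2 \<le> t" "t \<le> T / 2" for t
    using S_half order.antisym[OF that] by simp
  have eq: "integral {0..T/2} (\<lambda>t. (1 * C t - \<phi> (S t))\<^sup>2) = integral {0..T/2} (\<lambda>t. 0)"
    by (rule integral_cong) (auto simp: C_def)
  have eq': "integral {T/2..T} (\<lambda>t. (1 * C t + \<phi> (S t))\<^sup>2) = integral {T/2..T} (\<lambda>t. 0)"
    by (rule integral_cong) (use half in \<open>auto simp: C_def\<close>)
  have "\<bar>S t\<bar> \<le> 1" if "t \<in> {0..T}" for t using S_range[OF that] by simp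
  then have "0 = integral {0..T} (\<lambda>t. (C t)\<^sup>2) - 4 * J + (T - A)"
    using defect_identity[of S C "T/2" 1] eq eq' S_deriv continuous_on_C T_pos
    by (simp add: A_def)
  then show ?thesis
    using integral_unique[OF integral_C_sq] T_eq_A by (simp add: algebra_simps)
qed

lemma J_pos: "0 < J"
  unfolding J_eq using A_pos q by simp

text \<open>Until the first time that \<open>u\<close> reaches 1, F(u) has derivative 1, so F(u(t))
  = t; hence that time is F(1) = T/2. Afterwards \<open>u\<close> may rest at 1, which is why only
  [0, T/2] is described.\<close>

lemma rising_arc_unique:
  assumes u: "\<And>t. t \<in> {0..m} \<Longrightarrow> (u has_real_derivative \<phi> (u t)) (at t within {0..m})"
    and m: "0 \<le> m" and u0: "u 0 = 0" and um: "u m = 1"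
    and le1: "\<And>t. t \<in> {0..m} \<Longrightarrow> \<bar>u t\<bar> \<le> 1"
  shows "T / 2 \<le> m" and "\<And>t. t \<in> {0..T/2} \<Longrightarrow> u t = S t"
proof -
  have cu: "continuous_on {0..m} u" using u by (rule DERIV_continuous_on)
  define Z where "Z = {t \<in> {0..m}. u t = 1}"
  have "closed Z" unfolding Z_def
    by (rule continuous_closed_preimage_constant[OF cu]) auto
  moreover have "bounded Z" unfolding Z_def by (rule bounded_subset[of "{0..m}"]) auto
  moreover have "Z \<noteq> {}" using m um by (auto simp: Z_def)
  ultimately obtain m0 where m0: "m0 \<in> Z" and least: "\<And>t. t \<in> Z \<Longrightarrow> m0 \<le> t"
    using compact_attains_inf[of Z] by (auto simp: compact_eq_bounded_closed)
  have m0': "0 < m0" "m0 \<le> m" "u m0 = 1"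
    using m0 u0 by (auto simp: Z_def less_le)
  \<comment> \<open>\<open>u\<close> increases because its derivative \<phi>(u) is
    nonnegative.\<close>
  have nonneg: "0 \<le> u t" if "t \<in> {0..m}" for t
  proof -
    have "u 0 \<le> u t"
    proof (rule DERIV_nonneg_imp_increasing_open[of 0 t u])
      show "\<exists>y. (u has_real_derivative y) (at x) \<and> 0 \<le> y" if "0 < x" "x < t" for x
        using u[of x] \<phi>_nonneg[OF le1[of x]] that \<open>t \<in> {0..m}\<close> at_within_Icc_at[of 0 x m] by auto
    qed (use that cu in \<open>auto intro: continuous_on_subset\<close>)
    then show ?thesis using u0 by simp
  qed
  have below: "F (u t) = t" if t: "0 \<le> t" "t < m0" for t
  proof (cases "t = 0")
    case False
    have lt: "u x < 1" if "x \<in> {0..t}" for x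
      using le1[of x] least[of x] that t m0' by (auto simp: Z_def abs_le_iff less_le)
    \<comment> \<open>By compactness \<open>u\<close> stays below some b < 1 on [0, t], where
      \<open>F\<close> is differentiable.\<close>
    obtain x0 where x0: "x0 \<in> {0..t}" and max: "\<And>x. x \<in> {0..t} \<Longrightarrow> u x \<le> u x0"
      using continuous_attains_sup[of "{0..t}" u] continuous_on_subset[OF cu, of "{0..t}"] t m0' by auto
    obtain b where b: "u x0 < b" "b < 1" using dense lt[OF x0] by blast
    have der: "((\<lambda>x. F (u x)) has_real_derivative 1) (at x within {0..t})" if x: "x \<in> {0..t}" for x
    proof -
      have ux: "0 \<le> u x" "u x < b" using nonneg[of x] max[of x] b x t m0' by auto
      have "(F has_real_derivative 1 / \<phi> (u x)) (at (u x) within u ` {0..t})"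
      proof (rule DERIV_subset[OF F_deriv[of "u x" b]])
        show "u ` {0..t} \<subseteq> {0..b}" using nonneg max b t m0' by force
      qed (use ux b in auto)
      from DERIV_image_chain[OF this DERIV_subset[OF u]]
      have "((F \<circ> u) has_real_derivative 1 / \<phi> (u x) * \<phi> (u x)) (at x within {0..t})"
        using x t m0' by auto
      then show ?thesis using \<phi>_pos[of "u x"] ux b by (simp add: o_def)
    qed
    have "((\<lambda>x. 1) has_integral F (u t) - F (u 0)) {0..t}"
      using der t by (intro fundamental_theorem_of_calculus)
        (auto simp flip: has_real_derivative_iff_has_vector_derivative)
    moreover have "((\<lambda>x. 1) has_integral t) {0..t}"
      using has_integral_const_real[of "1::real" 0 t] t by simp
    ultimately have "F (u t) - F (u 0) = t" by (rule has_integral_unique)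
    then show ?thesis by (simp add: u0)
  qed (simp add: u0)
  have range: "u t \<in> {0..1}" if "t \<in> {0..m}" for t
    using nonneg[OF that] le1[OF that] by simp
  have "continuous_on {0..m0} (\<lambda>t. F (u t))"
    by (rule continuous_on_compose2[OF continuous_on_F continuous_on_subset[OF cu]])
       (use range m0' in auto)
  then have cF: "continuous_on {0..m0} (\<lambda>t. F (u t) - t)"
    by (intro continuous_intros)
  \<comment> \<open>At \<open>m0\<close> the derivative of \<open>F\<close> blows up, so this point
    is reached by continuity.\<close>
  have all: "F (u t) = t" if "t \<in> {0..m0}" for t
  proof -
    have "F (u t) - t = 0"
    proof (rule continuous_constant_on_closure[of "{0..<m0}" "\<lambda>t. F (u t) - t"])
      show "continuous_on (closure {0..<m0}) (\<lambda>t. F (u t) - t)" using cF m0' by simp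
      show "t \<in> closure {0..<m0}" using that m0' by simp
    qed (use below in auto)
    then show ?thesis by simp
  qed
  have "m0 = T / 2" using all[of m0] m0' F_1 by auto
  then show "T / 2 \<le> m" using m0' by simp
  fix t assume "t \<in> {0..T/2}"
  then have "F (u t) = t" "t \<in> {0..m}" using all[of t] \<open>m0 = T / 2\<close> m0' by auto
  then show "u t = S t" using S_F[OF range[of t]] by simp
qed

text \<open>With z as below, z - 1 = (2/q)(1 - y), so ln x \<le> x - 1 applied to \<open>y\<close>
  and \<open>z\<close> gives (2/q) ln y + ln z \<le> 0. Equality forces ln y = y - 1, hence y =
  1.\<close>

lemma concave_bound:
  assumes "0 < y" "y < 1 + q/2"
  shows "y powr (2 / q) * (1 + q / 2 - y) \<le> q / 2"
    and "y powr (2 / q) * (1 + q / 2 - y) = q / 2 \<Longrightarrow> y = 1"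
proof -
  define z where "z = (1 + q/2 - y) / (q / 2)"
  have z: "0 < z" and z': "z = 1 + (2/q) * (1 - y)" using assms q by (auto simp: z_def field_simps)
  have l: "ln (y powr (2/q) * z) = (2/q) * ln y + ln z"
    using assms z by (simp add: ln_mult)
  have 1: "ln y \<le> y - 1" using assms by (intro ln_le_minus_one)
  have 2: "ln z \<le> z - 1" using z by (intro ln_le_minus_one)
  have "(2/q) * ln y \<le> (2/q) * (y - 1)" using 1 q by (intro mult_left_mono) auto
  then have le: "ln (y powr (2/q) * z) \<le> 0" using 2 z' unfolding l right_diff_distrib by simp
  then have "y powr (2/q) * z \<le> 1" using assms z by (simp add: ln_le_zero_iff)
  then show "y powr (2 / q) * (1 + q / 2 - y) \<le> q / 2"
    using q by (simp add: z_def field_simps)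
  assume "y powr (2 / q) * (1 + q / 2 - y) = q / 2"
  then have "y powr (2/q) * z = 1" using q by (simp add: z_def field_simps)
  then have "(2/q) * ln y + ln z = 0" using l by simp
  then have "(2/q) * (y - 1 - ln y) \<le> (2/q) * 0" using 2 z' by (simp only: right_diff_distrib)
  then have "y - 1 - ln y \<le> 0" by (rule mult_left_le_imp_le) (use q in simp)
  then have "ln y = y - 1" using 1 by simp
  then show "y = 1" using ln_eq_minus_one assms by blast
qed

lemma poincare_normalised:
  assumes u: "\<And>t. t \<in> {0..T} \<Longrightarrow> (u has_real_derivative v t) (at t within {0..T})"
    and v: "continuous_on {0..T} v"
    and bc: "u 0 = 0" "u T = 0" and le1: "\<And>t. t \<in> {0..T} \<Longrightarrow> \<bar>u t\<bar> \<le> 1"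
    and m: "m \<in> {0..T}" "u m = 1"
  defines "D \<equiv> integral {0..T} (\<lambda>t. (v t)\<^sup>2)" and "B \<equiv> integral {0..T} (\<lambda>t. \<bar>u t\<bar> powr q)"
  shows "q / 2 * A * (B / A) powr (2 / q) \<le> D"
    and "q / 2 * A * (B / A) powr (2 / q) = D \<Longrightarrow> t \<in> {0..T} \<Longrightarrow> u t = S t"
proof -
  note id = defect_identity[OF u v bc le1 m, folded D_def B_def]
  have ge: "0 \<le> k\<^sup>2 * D - 4 * k * J + (T - B)" for k
  proof -
    have "0 \<le> integral {0..m} (\<lambda>t. (k * v t - \<phi> (u t))\<^sup>2) + integral {m..T} (\<lambda>t. (k * v t + \<phi> (u t))\<^sup>2)"
      by (intro add_nonneg_nonneg integral_square_nonneg)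
    also have "\<dots> = k\<^sup>2 * D - 4 * k * J + (T - B)" by (rule id)
    finally show ?thesis .
  qed
  have cu: "continuous_on {0..T} u" using u by (rule DERIV_continuous_on)
  have cphi: "continuous_on {0..T} (\<lambda>t. \<phi> (u t))"
    by (rule continuous_on_compose2[OF continuous_on_\<phi>[of UNIV] cu]) auto
  have cp: "continuous_on {0..T} (\<lambda>t. \<bar>u t\<bar> powr q)"
    by (intro continuous_intros continuous_on_powr' cu) (use q in auto)
  have D0: "0 \<le> D" unfolding D_def
    by (rule integral_nonneg) (auto intro!: integrable_continuous_interval continuous_intros v)
  have "D \<noteq> 0"
  proof
    assume "D = 0"
    then have "0 \<le> - 4 * k * J + (T - B)" for k using ge[of k] by simp
    \<comment> \<open>Without its quadratic term the polynomial is unbounded below; at this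
      \<open>k\<close> it equals -1.\<close>
    from this[of "(T - B + 1) / (4 * J)"] show False using J_pos by (simp add: field_simps)
  qed
  with D0 have D: "0 < D" by simp
  \<comment> \<open>The minimum of the quadratic in \<open>k\<close> is at k = 2 J / D.\<close>
  have "0 \<le> (2 * J / D)\<^sup>2 * D - 4 * (2 * J / D) * J + (T - B)" by (rule ge)
  also have "(2 * J / D)\<^sup>2 * D - 4 * (2 * J / D) * J = - (2 * J)\<^sup>2 / D"
    using D by (simp add: field_simps power2_eq_square)
  finally have cs: "(2 * J)\<^sup>2 \<le> (T - B) * D" using D by (simp add: field_simps)
  have "0 < (2 * J)\<^sup>2" using J_pos by simp
  then have TB: "0 < T - B" using cs D by (smt (verit) mult_nonpos_nonneg)
  have B0: "0 \<le> B" unfolding B_def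
    by (rule integral_nonneg) (auto intro!: integrable_continuous_interval cp)
  have "B \<noteq> 0"
  proof
    assume "B = 0"
    then have "((\<lambda>t. \<bar>u t\<bar> powr q) has_integral 0) {0..T}"
      unfolding B_def by (metis cp integrable_continuous_interval integrable_integral)
    then have "\<bar>u m\<bar> powr q = 0"
      using m T_pos cp by (intro has_integral_0_cbox_imp_0[of 0 T "\<lambda>t. \<bar>u t\<bar> powr q"]) auto
    then show False using m by (simp del: powr_eq_0_iff)
  qed
  \<comment> \<open>Normalised so that the sine has y = 1.\<close>
  define y where "y = B / A"
  have y: "0 < y" "y < 1 + q/2"
    using B0 \<open>B \<noteq> 0\<close> A_pos TB T_eq_A by (auto simp: y_def field_simps)
  have TB': "T - B = A * (1 + q/2 - y)" using A_pos T_eq_A by (simp add: y_def field_simps)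
  have J2: "2 * J = q / 2 * A" using J_eq by simp
  have cs': "(q / 2)\<^sup>2 * A \<le> (1 + q/2 - y) * D"
  proof -
    have "A * ((q / 2)\<^sup>2 * A) \<le> A * ((1 + q/2 - y) * D)"
      using cs unfolding J2 TB' by (simp add: power2_eq_square algebra_simps)
    then show ?thesis using A_pos by simp
  qed
  have P: "0 < 1 + q/2 - y" using y by simp
  have "(1 + q/2 - y) * (q / 2 * A * y powr (2/q)) = (q / 2 * A) * (y powr (2/q) * (1 + q/2 - y))" by simp
  also have "\<dots> \<le> (q / 2 * A) * (q / 2)"
    using concave_bound(1)[OF y] A_pos q by (intro mult_left_mono) auto
  also have "\<dots> = (q / 2)\<^sup>2 * A" by (simp add: power2_eq_square)
  finally have le: "(1 + q/2 - y) * (q / 2 * A * y powr (2/q)) \<le> (q / 2)\<^sup>2 * A" .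
  then have "(1 + q/2 - y) * (q / 2 * A * y powr (2/q)) \<le> (1 + q/2 - y) * D" using cs' by simp
  then show "q / 2 * A * (B / A) powr (2 / q) \<le> D" using P by (simp add: y_def)
  assume eq: "q / 2 * A * (B / A) powr (2 / q) = D" and t: "t \<in> {0..T}"
  \<comment> \<open>The two estimates \<open>le\<close> and \<open>cs'\<close> now enclose the same
    quantity, so both are equalities.\<close>
  have "(1 + q/2 - y) * (q / 2 * A * y powr (2/q)) = (q / 2)\<^sup>2 * A"
    using cs' le unfolding y_def eq by (rule order.antisym[rotated])
  then have "(q / 2 * A) * (y powr (2/q) * (1 + q/2 - y)) = (q / 2 * A) * (q / 2)"
    by (simp add: power2_eq_square algebra_simps)
  then have "y powr (2/q) * (1 + q/2 - y) = q / 2" using A_pos q by (simp only: mult_cancel_left) auto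
  then have y1: "y = 1" using concave_bound(2)[OF y] by blast
  then have B: "B = A" and "D = q / 2 * A" using A_pos eq by (auto simp: y_def)
  \<comment> \<open>At y = 1 the optimal k = 2 J / D equals 1, and the total defect is 0
    there.\<close>
  then have "integral {0..m} (\<lambda>t. (1 * v t - \<phi> (u t))\<^sup>2) + integral {m..T} (\<lambda>t. (1 * v t + \<phi> (u t))\<^sup>2) = 0"
    using id[of 1] J_eq T_eq_A by (simp add: algebra_simps)
  moreover have "0 \<le> integral {0..m} (\<lambda>t. (1 * v t - \<phi> (u t))\<^sup>2)" "0 \<le> integral {m..T} (\<lambda>t. (1 * v t + \<phi> (u t))\<^sup>2)"
    by (auto intro!: integral_square_nonneg)
  ultimately have z: "integral {0..m} (\<lambda>t. (v t - \<phi> (u t))\<^sup>2) = 0" "integral {m..T} (\<lambda>t. (v t + \<phi> (u t))\<^sup>2) = 0"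
    by simp_all
  have mm: "0 < m" "m < T" using m bc by (auto simp: less_le)
  have v1: "v t = \<phi> (u t)" if "t \<in> {0..m}" for t
    using continuous_zero_if_integral_square_zero[OF continuous_on_subset[OF continuous_on_diff[OF v cphi]] z(1) that] mm
    by simp
  have v2: "v t = - \<phi> (u t)" if "t \<in> {m..T}" for t
    using continuous_zero_if_integral_square_zero[OF continuous_on_subset[OF continuous_on_add[OF v cphi]] z(2) that] mm
    by simp
  have rise: "T / 2 \<le> m" "\<And>t. t \<in> {0..T/2} \<Longrightarrow> u t = S t"
  proof -
    have "(u has_real_derivative \<phi> (u t)) (at t within {0..m})" if "t \<in> {0..m}" for t
      using DERIV_subset[OF u[of t], of "{0..m}"] v1[OF that] that mm by simp
    then show "T / 2 \<le> m" "\<And>t. t \<in> {0..T/2} \<Longrightarrow> u t = S t"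
      using rising_arc_unique[of m u] mm bc m le1 by auto
  qed
  \<comment> \<open>Time reversal turns the falling arc into a rising one; together the arcs cover
    [0, T], leaving no time at rest.\<close>
  have fall: "\<And>t. t \<in> {0..T/2} \<Longrightarrow> u (T - t) = S t"
  proof (rule rising_arc_unique(2)[of "T - m" "\<lambda>t. u (T - t)"])
    show "((\<lambda>t. u (T - t)) has_real_derivative \<phi> (u (T - t))) (at t within {0..T - m})" if t: "t \<in> {0..T - m}" for t
    proof -
      have img: "(\<lambda>t. T - t) ` {0..T - m} \<subseteq> {0..T}" using mm by auto
      have "(u has_real_derivative v (T - t)) (at (T - t) within (\<lambda>t. T - t) ` {0..T - m})"
        by (rule DERIV_subset[OF u img]) (use t mm in auto)
      moreover have "((\<lambda>t. T - t) has_real_derivative -1) (at t within {0..T - m})"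
        by (auto intro!: derivative_eq_intros)
      ultimately have "(u \<circ> (\<lambda>t. T - t) has_real_derivative v (T - t) * (-1)) (at t within {0..T - m})"
        by (rule DERIV_image_chain)
      then show ?thesis using v2[of "T - t"] t mm by (simp add: o_def)
    qed
    show "\<bar>u (T - t)\<bar> \<le> 1" if "t \<in> {0..T - m}" for t
      by (rule le1) (use that mm in auto)
  qed (use mm bc m in auto)
  show "u t = S t"
    using rise(2)[of t] fall[of "T - t"] S_reflect[of t] t by (cases "t \<le> T/2") auto
qed

theorem poincare:
  assumes u: "\<And>t. t \<in> {0..T} \<Longrightarrow> (u has_real_derivative v t) (at t within {0..T})"
    and v: "continuous_on {0..T} v"
    and bc: "u 0 = 0" "u T = 0" and nz: "\<exists>t\<in>{0..T}. u t \<noteq> 0"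
  defines "D \<equiv> integral {0..T} (\<lambda>t. (v t)\<^sup>2)" and "B \<equiv> integral {0..T} (\<lambda>t. \<bar>u t\<bar> powr q)"
  shows "q / 2 * A * (B / A) powr (2 / q) \<le> D"
    and "q / 2 * A * (B / A) powr (2 / q) = D \<Longrightarrow> \<exists>c. c \<noteq> 0 \<and> (\<forall>t\<in>{0..T}. u t = c * S t)"
proof -
  have cu: "continuous_on {0..T} u" using u by (rule DERIV_continuous_on)
  obtain m where m: "m \<in> {0..T}" and max: "\<And>t. t \<in> {0..T} \<Longrightarrow> \<bar>u t\<bar> \<le> \<bar>u m\<bar>"
    using continuous_attains_sup[of "{0..T}" "\<lambda>t. \<bar>u t\<bar>"] continuous_on_rabs[OF cu] T_pos by fastforce
  \<comment> \<open>Dividing by the signed value makes the normalised maximum +1; both sides of the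
    inequality scale by c^2.\<close>
  define c where "c = u m"
  have c: "c \<noteq> 0" using nz max by (force simp: c_def)
  have le1: "\<bar>u t / c\<bar> \<le> 1" if "t \<in> {0..T}" for t
    using max[OF that] c by (simp add: c_def field_simps)
  have du: "((\<lambda>t. u t / c) has_real_derivative v t / c) (at t within {0..T})" if "t \<in> {0..T}" for t
    using u[OF that] by (rule DERIV_cdivide)
  have cv: "continuous_on {0..T} (\<lambda>t. v t / c)" using c v by (intro continuous_intros) auto
  have "(\<lambda>t. (v t / c)\<^sup>2) = (\<lambda>t. (v t)\<^sup>2 / c\<^sup>2)" "(\<lambda>t. \<bar>u t / c\<bar> powr q) = (\<lambda>t. \<bar>u t\<bar> powr q / \<bar>c\<bar> powr q)"
    by (auto simp: power_divide powr_divide)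
  then have D': "integral {0..T} (\<lambda>t. (v t / c)\<^sup>2) = D / c\<^sup>2"
    and B': "integral {0..T} (\<lambda>t. \<bar>u t / c\<bar> powr q) = B / \<bar>c\<bar> powr q"
    by (simp_all add: D_def B_def)
  have "(\<bar>c\<bar> powr q) powr (2 / q) = c\<^sup>2" using q by (simp add: powr_powr)
  then have sc: "(B / \<bar>c\<bar> powr q / A) powr (2/q) = (B / A) powr (2/q) / c\<^sup>2"
    by (simp add: powr_divide powr_mult)
  note pn = poincare_normalised[OF du cv _ _ le1 m, unfolded D' B' sc]
  have c2: "0 < c\<^sup>2" using c by simp
  have bc': "u 0 / c = 0" "u T / c = 0" "u m / c = 1" using bc c by (simp_all add: c_def)
  have "q / 2 * A * ((B / A) powr (2/q) / c\<^sup>2) \<le> D / c\<^sup>2"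
    by (rule pn(1)[OF _ bc'(1,2) _ bc'(3)])
  from mult_right_mono[OF this less_imp_le[OF c2]]
  show "q / 2 * A * (B / A) powr (2 / q) \<le> D" using c2 by simp
  assume "q / 2 * A * (B / A) powr (2 / q) = D"
  then have eq: "q / 2 * A * ((B / A) powr (2/q) / c\<^sup>2) = D / c\<^sup>2" by simp
  have "u t / c = S t" if "t \<in> {0..T}" for t
    by (rule pn(2)[OF _ bc'(1,2) _ bc'(3) eq that])
  then show "\<exists>c. c \<noteq> 0 \<and> (\<forall>t\<in>{0..T}. u t = c * S t)"
    using c by (intro exI[of _ c]) (auto simp: field_simps)
qed

end

section \<open>Test functions and weak derivatives\<close>

lemma DERIV_quadratic_bound:
  fixes f :: "real \<Rightarrow> real"
  assumes "\<And>x. \<bar>f x\<bar> \<le> K * (x - z)\<^sup>2"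
  shows "(f has_real_derivative 0) (at z)"
proof -
  have "f z = 0" using assms[of z] by simp
  have "((\<lambda>h. f (z + h) / h) \<longlongrightarrow> 0) (at 0)"
  proof (rule Lim_null_comparison)
    show "\<forall>\<^sub>F h in at 0. norm (f (z + h) / h) \<le> \<bar>K\<bar> * \<bar>h\<bar>"
    proof (rule always_eventually, rule allI)
      fix h :: real
      have "\<bar>f (z + h)\<bar> \<le> K * h\<^sup>2" using assms[of "z + h"] by simp
      also have "\<dots> \<le> \<bar>K\<bar> * \<bar>h\<bar> * \<bar>h\<bar>" by (simp add: power2_eq_square mult_right_mono mult.assoc)
      finally show "norm (f (z + h) / h) \<le> \<bar>K\<bar> * \<bar>h\<bar>"
        by (cases "h = 0") (simp_all add: field_simps)
    qed
    show "((\<lambda>h. \<bar>K\<bar> * \<bar>h\<bar>) \<longlongrightarrow> 0) (at 0)"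
      by (auto intro!: tendsto_eq_intros)
  qed
  then show ?thesis using \<open>f z = 0\<close> by (simp add: DERIV_def)
qed

text \<open>The derivatives of the bump \<open>exp (- c / ((x - a) * (b - x)))\<close> all belong to the following
  family, which is closed under differentiation.\<close>

definition bump :: "real \<Rightarrow> real \<Rightarrow> real \<Rightarrow> real poly \<Rightarrow> nat \<Rightarrow> real \<Rightarrow> real" where
  "bump c a b P k x = (if a < x \<and> x < b
     then poly P x / ((x - a) * (b - x)) ^ k * exp (- c / ((x - a) * (b - x))) else 0)"

text \<open>\<open>Y\<close> is (x - a)(b - x) multiplied out; the body is the numerator of (P
  Y^(-k) exp(-c/Y))' over the denominator Y^(k+2).\<close>

definition bump_deriv_poly :: "real \<Rightarrow> real \<Rightarrow> real \<Rightarrow> real poly \<Rightarrow> nat \<Rightarrow> real poly" where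
  "bump_deriv_poly c a b P k = (let Y = [:- a * b, a + b, - 1:] in
     pderiv P * Y\<^sup>2 - smult (of_nat k) (P * pderiv Y * Y) + smult c (P * pderiv Y))"

text \<open>The exponential beats every power of y = (x - a)(b - x), and y \<le> (b - a)|x - z| for
  \<open>z\<close> outside the interval. A single estimate thus gives derivative 0 at the end points
  and beyond.\<close>

lemma bump_quadratic_bound:
  assumes c: "0 < c"
  obtains K where "\<And>x z. z \<notin> {a<..<b} \<Longrightarrow> \<bar>bump c a b P k x\<bar> \<le> K * (x - z)\<^sup>2"
proof -
  obtain M where M: "\<And>x. x \<in> {a..b} \<Longrightarrow> \<bar>poly P x\<bar> \<le> M"
  proof -
    have "compact (poly P ` {a..b})" by (intro compact_continuous_image continuous_intros) auto
    then have "bounded (poly P ` {a..b})" by (rule compact_imp_bounded)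
    then obtain M where "\<forall>x\<in>poly P ` {a..b}. norm x \<le> M" unfolding bounded_iff by blast
    then show ?thesis by (intro that[of M]) auto
  qed
  \<comment> \<open>exp(-c/y) \<le> (n/c)^n y^n follows from (1 + s/n)^n \<le> exp(s) with s = c/y;
    \<open>k\<close> powers of \<open>y\<close> cancel the denominator and two remain.\<close>
  define n where "n = k + 2"
  define L where "L = (real n / c) ^ n"
  have L: "0 \<le> L" using c by (simp add: L_def)
  define K where "K = \<bar>M\<bar> * L * (b - a)\<^sup>2"
  have K: "0 \<le> K" using L by (simp add: K_def)
  have "\<bar>bump c a b P k x\<bar> \<le> K * (x - z)\<^sup>2" if z: "z \<notin> {a<..<b}" for x z
  proof (cases "a < x \<and> x < b")
    case True
    define y where "y = (x - a) * (b - x)"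
    have y: "0 < y" using True by (simp add: y_def)
    have "(c / y / real n) ^ n \<le> (1 + c / y / real n) ^ n"
      using c y by (intro power_mono) auto
    also have "\<dots> \<le> exp (c / y)"
    proof (rule exp_ge_one_plus_x_over_n_power_n)
      have "0 < c / y" using c y by simp
      then show "- real n \<le> c / y" by linarith
    qed (simp add: n_def)
    finally have "exp (- (c / y)) \<le> inverse ((c / y / real n) ^ n)"
      unfolding exp_minus using c y by (intro le_imp_inverse_le) (auto simp: n_def)
    also have "\<dots> = L * y ^ n"
    proof -
      have "inverse (c / y / real n) = real n / c * y" by (simp add: field_simps)
      then show ?thesis by (simp only: power_inverse[symmetric] L_def power_mult_distrib)
    qed
    also have "\<dots> = L * y\<^sup>2 * y ^ k" by (simp add: n_def power_add power2_eq_square)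
    finally have "exp (- c / y) / y ^ k \<le> L * y\<^sup>2" using y by (simp add: field_simps)
    moreover have "y\<^sup>2 \<le> (b - a)\<^sup>2 * (x - z)\<^sup>2"
    proof -
      have "y \<le> (b - a) * \<bar>x - z\<bar>"
      proof (cases "z \<le> a")
        case True
        then have "y \<le> (x - a) * (b - a)" "(x - a) * (b - a) \<le> \<bar>x - z\<bar> * (b - a)"
          unfolding y_def using \<open>a < x \<and> x < b\<close> by (auto intro!: mult_mono)
        then show ?thesis by (simp add: mult.commute)
      next
        case False
        then have "y \<le> (b - a) * (b - x)" "(b - a) * (b - x) \<le> (b - a) * \<bar>x - z\<bar>"
          unfolding y_def using \<open>a < x \<and> x < b\<close> z by (auto intro!: mult_mono)
        then show ?thesis by simp
      qed
      then have "y\<^sup>2 \<le> ((b - a) * \<bar>x - z\<bar>)\<^sup>2" using y by (intro power_mono) auto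
      then show ?thesis by (simp add: power_mult_distrib)
    qed
    ultimately have "exp (- c / y) / y ^ k \<le> L * ((b - a)\<^sup>2 * (x - z)\<^sup>2)"
      using L by (meson mult_left_mono order_trans)
    then have "\<bar>poly P x\<bar> * (exp (- c / y) / y ^ k) \<le> \<bar>M\<bar> * (L * ((b - a)\<^sup>2 * (x - z)\<^sup>2))"
      using M[of x] True y by (intro mult_mono) auto
    then show ?thesis
      using True y by (simp add: bump_def K_def abs_mult mult.assoc flip: y_def)
  next
    case False
    then have "bump c a b P k x = 0" by (auto simp: bump_def)
    then show ?thesis using K by simp
  qed
  then show ?thesis using that by blast
qed

lemma bump_deriv:
  assumes c: "0 < c"
  shows "(bump c a b P k has_real_derivative bump c a b (bump_deriv_poly c a b P k) (k + 2) x) (at x)"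
proof (cases "x \<in> {a<..<b}")
  case True
  define y where "y = (x - a) * (b - x)"
  have y: "y \<noteq> 0" using True by (auto simp: y_def)
  have "((\<lambda>x. poly P x / ((x - a) * (b - x)) ^ k * exp (- c / ((x - a) * (b - x)))) has_real_derivative
     bump c a b (bump_deriv_poly c a b P k) (k + 2) x) (at x)"
  proof -
    define Y where "Y = [:- a * b, a + b, - 1:]"
    have Y: "poly Y x = (x - a) * (b - x)" for x by (simp add: Y_def algebra_simps)
    have Yx: "poly Y x = y" by (simp add: Y y_def)
    \<comment> \<open>For k = 0 the subtraction is truncated, and both sides are 0.\<close>
    have pw: "real k * y ^ (k - Suc 0) = real k * y ^ k / y"
      using y by (cases k) auto
    have "((\<lambda>x. poly P x / poly Y x ^ k * exp (- c / poly Y x)) has_real_derivative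
       (poly (pderiv P) x * y ^ k - poly P x * (real k * y ^ k / y * poly (pderiv Y) x)) / (y ^ k * y ^ k) * exp (- c / y)
         + poly P x / y ^ k * (exp (- c / y) * (c * poly (pderiv Y) x / (y * y)))) (at x)"
      using y pw by (auto intro!: derivative_eq_intros poly_DERIV simp: Yx field_simps)
    moreover have "(poly (pderiv P) x * y ^ k - poly P x * (real k * y ^ k / y * poly (pderiv Y) x)) / (y ^ k * y ^ k) * exp (- c / y)
         + poly P x / y ^ k * (exp (- c / y) * (c * poly (pderiv Y) x / (y * y))) =
         bump c a b (bump_deriv_poly c a b P k) (k + 2) x"
    proof -
      have "poly (bump_deriv_poly c a b P k) x = poly (pderiv P) x * y\<^sup>2
          - real k * (poly P x * poly (pderiv Y) x * y) + c * (poly P x * poly (pderiv Y) x)"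
        unfolding bump_deriv_poly_def Let_def Y_def[symmetric] by (simp add: Yx)
      then have "bump c a b (bump_deriv_poly c a b P k) (k + 2) x = (poly (pderiv P) x * y\<^sup>2
          - real k * (poly P x * poly (pderiv Y) x * y) + c * (poly P x * poly (pderiv Y) x)) / (y ^ k * y\<^sup>2) * exp (- c / y)"
        using True by (simp add: bump_def power_add power2_eq_square flip: y_def)
      moreover have "(p' * w - p * (n * w / y * d)) / (w * w) * e + p / w * (e * (c * d / (y * y))) =
          (p' * y\<^sup>2 - n * (p * d * y) + c * (p * d)) / (w * y\<^sup>2) * e" if "w \<noteq> 0" for p p' w n d e :: real
        using that y by (simp add: field_simps power2_eq_square)
      ultimately show ?thesis using y by simp
    qed
    ultimately show ?thesis by (simp add: Y)
  qed
  then show ?thesis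
  proof (rule DERIV_cong_ev[THEN iffD1, rotated 3, OF _ refl _ refl])
    have "eventually (\<lambda>z. z \<in> {a<..<b}) (nhds x)"
      using True by (intro eventually_nhds_in_open) auto
    then show "\<forall>\<^sub>F z in nhds x. poly P z / ((z - a) * (b - z)) ^ k * exp (- c / ((z - a) * (b - z))) = bump c a b P k z"
      by eventually_elim (simp add: bump_def)
  qed
next
  case False
  obtain K where "\<And>x z. z \<notin> {a<..<b} \<Longrightarrow> \<bar>bump c a b P k x\<bar> \<le> K * (x - z)\<^sup>2"
    using bump_quadratic_bound[OF c] by blast
  then have "(bump c a b P k has_real_derivative 0) (at x)"
    using False by (intro DERIV_quadratic_bound) auto
  moreover have "bump c a b (bump_deriv_poly c a b P k) (k + 2) x = 0"
    using False by (auto simp: bump_def)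
  ultimately show ?thesis by simp
qed

lemma bump_smooth:
  assumes c: "0 < c"
  shows "(deriv ^^ n) (bump c a b P k) differentiable (at x)"
proof -
  have "\<exists>Q j. (deriv ^^ n) (bump c a b P k) = bump c a b Q j"
  proof (induction n)
    case (Suc n)
    then obtain Q j where "(deriv ^^ n) (bump c a b P k) = bump c a b Q j" by blast
    moreover have "deriv (bump c a b Q j) = bump c a b (bump_deriv_poly c a b Q j) (j + 2)"
      using bump_deriv[OF c] by (intro ext DERIV_imp_deriv)
    ultimately show ?case by auto
  qed auto
  then show ?thesis using bump_deriv[OF c] real_differentiable_def by metis
qed

lemma test_functions_iff:
  assumes "0 < T"
  shows "\<phi> \<in> test_functions {0..T} \<longleftrightarrow>
    (\<forall>n x. (deriv ^^ n) \<phi> differentiable (at x)) \<and>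
    (\<exists>a b. 0 < a \<and> a < b \<and> b < T \<and> (\<forall>x. x \<notin> {a..b} \<longrightarrow> \<phi> x = 0))"
proof -
  define X where "X = {x. \<phi> x \<noteq> 0}"
  have "compact (closure X) \<and> closure X \<subseteq> {0<..<T} \<longleftrightarrow>
     (\<exists>a b. 0 < a \<and> a < b \<and> b < T \<and> (\<forall>x. x \<notin> {a..b} \<longrightarrow> \<phi> x = 0))" (is "?L \<longleftrightarrow> ?R")
  proof
    assume L: ?L
    show ?R
    proof (cases "closure X = {}")
      case True
      then show ?thesis using assms by (intro exI[of _ "T/3"] exI[of _ "T/2"]) (auto simp: X_def)
    next
      case False
      obtain a where a: "a \<in> closure X" "\<And>x. x \<in> closure X \<Longrightarrow> a \<le> x"
        using compact_attains_inf[of "closure X"] L False by blast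
      obtain b where b: "b \<in> closure X" "\<And>x. x \<in> closure X \<Longrightarrow> x \<le> b"
        using compact_attains_sup[of "closure X"] L False by blast
      have "0 < a" "a \<le> b" "b < T" using a b L by auto
      \<comment> \<open>Only a \<le> b is known, so the right end is moved to make the inequality
        strict.\<close>
      then obtain b' where b': "b < b'" "b' < T" using dense by blast
      have "\<phi> x = 0" if "x \<notin> {a..b'}" for x
        using a(2)[of x] b(2)[of x] that b' closure_subset[of X] by (force simp: X_def)
      then show ?thesis
        using \<open>0 < a\<close> \<open>a \<le> b\<close> b' by (intro exI[of _ a] exI[of _ b']) auto
    qed
  next
    assume ?R
    then obtain a b where ab: "0 < a" "a < b" "b < T" "\<forall>x. x \<notin> {a..b} \<longrightarrow> \<phi> x = 0" by blast
    then have "X \<subseteq> {a..b}" by (auto simp: X_def)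
    then have "closure X \<subseteq> {a..b}" by (simp add: closure_minimal)
    then show ?L using ab using bounded_subset[OF bounded_closed_interval] by (auto simp: compact_eq_bounded_closed)
  qed
  then show ?thesis
    by (simp add: test_functions_def X_def interior_atLeastAtMost_real)
qed

lemma bump_test:
  assumes "0 < c" "0 < a" "a < b" "b < T"
  shows "bump c a b P k \<in> test_functions {0..T}"
proof -
  have "0 < T" using assms by simp
  moreover have "\<forall>x. x \<notin> {a..b} \<longrightarrow> bump c a b P k x = 0" by (auto simp: bump_def)
  ultimately show ?thesis using assms bump_smooth by (auto simp: test_functions_iff)
qed

text \<open>As \<open>c\<close> tends to 0 the bump fills its interval; with dominated convergence
  this takes the place of mollifiers.\<close>

lemma bump_tendsto_indicator:
  "(\<lambda>n. bump (1 / real (Suc n)) a b 1 0 x) \<longlonglongrightarrow> indicator {a<..<b} x"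
proof (cases "x \<in> {a<..<b}")
  case True
  define y where "y = (x - a) * (b - x)"
  have "(\<lambda>n. exp (- (1 / real (Suc n)) / y)) \<longlonglongrightarrow> exp (- 0 / y)"
    using True LIMSEQ_inverse_real_of_nat[unfolded inverse_eq_divide]
    by (intro tendsto_exp tendsto_divide tendsto_minus tendsto_const) (auto simp: y_def)
  then show ?thesis using True by (simp add: bump_def flip: y_def)
next
  case False
  then have "bump c a b 1 0 x = 0" for c by (auto simp: bump_def)
  then show ?thesis using False by simp
qed

lemma bump_range: "0 < c \<Longrightarrow> bump c a b 1 0 x \<in> {0..1}"
  by (auto simp: bump_def)

section \<open>The fundamental lemma of the calculus of variations\<close>

text \<open>The positive and negative parts are densities of measures that are finite and equal on
  all rays; rays determine a Borel measure, so the densities agree almost everywhere.\<close>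

lemma AE_zero_if_integral_rays_zero:
  fixes f :: "real \<Rightarrow> real"
  assumes f: "integrable lebesgue f"
    and zero: "\<And>x. integral\<^sup>L lebesgue (\<lambda>t. indicator {x<..} t * f t) = 0"
  shows "AE x in lebesgue. f x = 0"
proof -
  \<comment> \<open>A Borel representative, because the comparison of measures takes place on Borel
    sets.\<close>
  obtain g where g[measurable]: "g \<in> borel_measurable lborel" and fg: "AE x in lborel. f x = g x"
    using completion_ex_borel_measurable_real borel_measurable_integrable[OF f] by blast
  have fg': "AE x in lebesgue. f x = g x" using fg by (rule AE_completion)
  have gm: "g \<in> borel_measurable lebesgue" using g by (rule measurable_completion)
  have gi: "integrable lborel g"
    using integrable_cong_AE_imp[OF f gm] fg' integrable_completion[OF g] by (auto simp: eq_commute)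
  have g0: "integral\<^sup>L lborel (\<lambda>t. indicator {x<..} t * g t) = 0" for x
  proof -
    have "integral\<^sup>L lborel (\<lambda>t. indicator {x<..} t * g t) = integral\<^sup>L lebesgue (\<lambda>t. indicator {x<..} t * g t)"
      by (rule integral_completion[symmetric]) measurable
    also have "\<dots> = integral\<^sup>L lebesgue (\<lambda>t. indicator {x<..} t * f t)"
      using fg' gm borel_measurable_integrable[OF f]
      by (intro integral_cong_AE borel_measurable_times measurable_completion[of "indicator _"]) auto
    finally show ?thesis using zero by simp
  qed
  define P where "P = density lborel (\<lambda>t. ennreal (g t))"
  define N where "N = density lborel (\<lambda>t. ennreal (- g t))"
  have fin: "(\<integral>\<^sup>+t. ennreal (g t) \<partial>lborel) \<noteq> \<infinity>" "(\<integral>\<^sup>+t. ennreal (- g t) \<partial>lborel) \<noteq> \<infinity>"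
    using gi by (auto simp: real_integrable_def)
  have le: "(\<integral>\<^sup>+t. ennreal (h t) * indicator X t \<partial>lborel) \<le> (\<integral>\<^sup>+t. ennreal (h t) \<partial>lborel)" for h :: "real \<Rightarrow> real" and X
    by (intro nn_integral_mono) (auto simp: indicator_def)
  have finP: "emeasure P {x<..} < \<infinity>" for x
    using le[of g "{x<..}"] fin(1) unfolding P_def by (subst emeasure_density) (auto simp: less_top top_unique)
  have finN: "emeasure N {x<..} < \<infinity>" for x
    using le[of "\<lambda>t. - g t" "{x<..}"] fin(2) unfolding N_def by (subst emeasure_density) (auto simp: less_top top_unique)
  have eq: "emeasure P {x<..} = emeasure N {x<..}" for x
  proof -
    have i: "integrable lborel (\<lambda>t. indicator {x<..} t * g t)"
      using integrable_mult_indicator[of "{x<..}" lborel g] gi by simp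
    have "enn2real (\<integral>\<^sup>+t. ennreal (indicator {x<..} t * g t) \<partial>lborel) = enn2real (emeasure P {x<..})"
      unfolding P_def by (subst emeasure_density) (auto intro!: arg_cong[where f = enn2real] nn_integral_cong simp: indicator_def)
    moreover have "enn2real (\<integral>\<^sup>+t. ennreal (- (indicator {x<..} t * g t)) \<partial>lborel) = enn2real (emeasure N {x<..})"
      unfolding N_def by (subst emeasure_density) (auto intro!: arg_cong[where f = enn2real] nn_integral_cong simp: indicator_def)
    ultimately have "enn2real (emeasure P {x<..}) = enn2real (emeasure N {x<..})"
      using real_lebesgue_integral_def[OF i] g0[of x] by simp
    then show ?thesis
      using finP[of x] finN[of x] by (metis ennreal_enn2real infinity_ennreal_def)
  qed
  have "P = N"
    by (rule measure_eqI_lessThan) (use finP eq in \<open>auto simp: P_def N_def\<close>)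
  then have "AE t in lborel. ennreal (g t) = ennreal (- g t)"
    unfolding P_def N_def
    by (intro sigma_finite_measure.density_unique[OF lborel.sigma_finite_measure_axioms]) auto
  then have "AE t in lborel. g t = 0"
  proof eventually_elim
    case (elim t)
    \<comment> \<open>\<open>ennreal\<close> truncates negative numbers to 0, so one of the two
      equal values is 0.\<close>
    then show ?case
      by (cases "g t \<ge> 0") (auto simp: ennreal_neg ennreal_eq_0_iff dest: sym)
  qed
  then show ?thesis
    using fg by (intro AE_completion) auto
qed

lemma locally_integrable_Icc:
  "locally_integrable {0..T} g \<Longrightarrow> 0 < a \<Longrightarrow> b < T \<Longrightarrow> set_integrable lebesgue {a..b} g"
  unfolding locally_integrable_def
  by (drule spec[of _ "{a..b}"]) (auto simp: interior_atLeastAtMost_real)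

lemma test_function_continuous:
  assumes "\<phi> \<in> test_functions I"
  shows "continuous_on A \<phi>" "(\<phi> has_real_derivative deriv \<phi> x) (at x)"
proof -
  have "\<phi> differentiable (at x)" for x
    using assms by (auto simp: test_functions_def dest!: spec[of _ "0::nat"])
  then show "(\<phi> has_real_derivative deriv \<phi> x) (at x)" "continuous_on A \<phi>"
    by (auto simp: DERIV_deriv_iff_real_differentiable differentiable_imp_continuous_within
        continuous_at_imp_continuous_on)
qed

text \<open>Bumps tending to an indicator show that \<open>g\<close> has integral 0 over every
  compactly contained open interval; the ray criterion then applies to truncations of
  \<open>g\<close>.\<close>

theorem fundamental_lemma:
  assumes T: "0 < T" and g: "locally_integrable {0..T} g"
    and zero: "\<And>\<phi>. \<phi> \<in> test_functions {0..T} \<Longrightarrow> integral\<^sup>L (lebesgue_on {0..T}) (\<lambda>x. g x * \<phi> x) = 0"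
  shows "AE x in lebesgue_on {0..T}. g x = 0"
proof -
  have Ioo: "integral\<^sup>L lebesgue (\<lambda>t. indicator {a<..<b} t * g t) = 0" if ab: "0 < a" "a < b" "b < T" for a b
  proof -
    have gi: "integrable lebesgue (\<lambda>t. indicator {a..b} t * g t)"
      using locally_integrable_Icc[OF g, of a b] ab by (simp add: set_integrable_def)
    let ?s = "\<lambda>n t. indicator {a..b} t * g t * bump (1 / real (Suc n)) a b 1 0 t"
    have lim: "(\<lambda>n. integral\<^sup>L lebesgue (?s n)) \<longlonglongrightarrow> integral\<^sup>L lebesgue (\<lambda>t. indicator {a..b} t * g t * indicator {a<..<b} t)"
    proof (rule integral_dominated_convergence)
      show "(\<lambda>t. indicator {a..b} t * g t * indicator {a<..<b} t) \<in> borel_measurable lebesgue"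
        by (rule borel_measurable_times[OF borel_measurable_integrable[OF gi] measurable_completion]) auto
      show "?s n \<in> borel_measurable lebesgue" for n
      proof (rule borel_measurable_times[OF borel_measurable_integrable[OF gi]])
        have "continuous_on UNIV (bump (1 / real (Suc n)) a b 1 0)"
          using test_function_continuous(1)[OF bump_test[of "1 / real (Suc n)" a b T 1 0]] ab by simp
        then show "bump (1 / real (Suc n)) a b 1 0 \<in> borel_measurable lebesgue"
          by (intro measurable_completion) (simp add: borel_measurable_continuous_onI)
      qed
      show "integrable lebesgue (\<lambda>t. \<bar>indicator {a..b} t * g t\<bar>)" using gi by simp
      show "AE t in lebesgue. (\<lambda>n. ?s n t) \<longlonglongrightarrow> indicator {a..b} t * g t * indicator {a<..<b} t"
        by (intro always_eventually allI tendsto_mult tendsto_const bump_tendsto_indicator)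
      show "AE t in lebesgue. norm (?s n t) \<le> \<bar>indicator {a..b} t * g t\<bar>" for n
        using bump_range[of "1 / real (Suc n)" a b]
        by (intro always_eventually allI) (auto simp: abs_mult intro!: mult_left_le)
    qed
    have "integral\<^sup>L lebesgue (?s n) = 0" for n
    proof -
      have "integral\<^sup>L (lebesgue_on {0..T}) (\<lambda>x. g x * bump (1 / real (Suc n)) a b 1 0 x) = 0"
        by (rule zero, rule bump_test) (use ab in auto)
      moreover have "integral\<^sup>L (lebesgue_on {0..T}) (\<lambda>x. g x * bump (1 / real (Suc n)) a b 1 0 x) = integral\<^sup>L lebesgue (?s n)"
        using ab by (subst integral_restrict_space)
          (auto intro!: Bochner_Integration.integral_cong simp: indicator_def bump_def)
      ultimately show ?thesis by simp
    qed
    with lim have "integral\<^sup>L lebesgue (\<lambda>t. indicator {a..b} t * g t * indicator {a<..<b} t) = 0"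
      by (simp add: LIMSEQ_const_iff)
    moreover have "(\<lambda>t. indicator {a..b} t * g t * indicator {a<..<b} t) = (\<lambda>t. indicator {a<..<b} t * g t)"
      by (auto simp: indicator_def)
    ultimately show ?thesis by simp
  qed
  \<comment> \<open>\<open>g\<close> need not be integrable up to the boundary, so (0, T) is
    exhausted from inside; the shift by 3 makes already the interval for n = 0 nonempty.\<close>
  define a where "a n = T / real (n + 3)" for n :: nat
  have a: "0 < a n" "a n < T - a n" "T - a n < T" for n
  proof -
    have "a n \<le> T / 3" unfolding a_def using T by (intro divide_left_mono) auto
    then show "0 < a n" "a n < T - a n" "T - a n < T" using T by (auto simp: a_def)
  qed
  have "AE x in lebesgue. indicator {a n<..<T - a n} x * g x = 0" for n
  proof (rule AE_zero_if_integral_rays_zero)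
    have "set_integrable lebesgue {a n<..<T - a n} g"
      by (rule set_integrable_subset[OF locally_integrable_Icc[OF g a(1)[of n] a(3)[of n]]]) auto
    then show "integrable lebesgue (\<lambda>x. indicator {a n<..<T - a n} x * g x)"
      by (simp add: set_integrable_def)
    fix x
    have "(\<lambda>t. indicator {x<..} t * (indicator {a n<..<T - a n} t * g t)) = (\<lambda>t. indicator {max x (a n)<..<T - a n} t * g t)"
      by (auto simp: indicator_def)
    then show "integral\<^sup>L lebesgue (\<lambda>t. indicator {x<..} t * (indicator {a n<..<T - a n} t * g t)) = 0"
      using Ioo[of "max x (a n)" "T - a n"] a[of n] by (cases "max x (a n) < T - a n") auto
  qed
  then have "AE x in lebesgue. \<forall>n. indicator {a n<..<T - a n} x * g x = 0"
    unfolding AE_all_countable by blast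
  moreover have "AE x in lebesgue. x \<noteq> 0" "AE x in lebesgue. x \<noteq> T"
    by (auto intro!: AE_completion AE_lborel_singleton)
  ultimately have "AE x in lebesgue. x \<in> {0..T} \<longrightarrow> g x = 0"
  proof eventually_elim
    case (elim x)
    show ?case
    proof
      assume "x \<in> {0..T}"
      then have x: "0 < min x (T - x)" using elim by auto
      have "a \<longlonglongrightarrow> 0" unfolding a_def[abs_def]
        using LIMSEQ_ignore_initial_segment[OF lim_const_over_n[of T], of 3] by simp
      then have "\<forall>\<^sub>F n in sequentially. a n < min x (T - x)" using x by (rule order_tendstoD)
      then obtain n where "a n < min x (T - x)" by (auto simp: eventually_sequentially)
      then show "g x = 0" using elim(1)[rule_format, of n] by auto
    qed
  qed
  then show ?thesis by (simp add: AE_restrict_space_iff)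
qed

section \<open>Primitives of integrable functions and integration by parts\<close>

lemma finite_measure_lebesgue_on_Icc: "finite_measure (lebesgue_on {a..b::real})"
  by (rule finite_measureI) (simp add: emeasure_restrict_space emeasure_lborel_Icc_eq)

lemma id_measurable_lebesgue_on [measurable]: "(\<lambda>x::real. x) \<in> borel_measurable (lebesgue_on A)"
  by (intro measurable_restrict_space1 measurable_completion) simp

lemma lebesgue_on_Icc_eq_integral:
  "integrable (lebesgue_on {a..b::real}) f \<Longrightarrow> integral\<^sup>L (lebesgue_on {a..b}) f = integral {a..b} (f :: real \<Rightarrow> real)"
  by (rule lebesgue_integral_eq_integral) auto

lemma integrable_imp_continuous_primitive:
  fixes g :: "real \<Rightarrow> real"
  assumes "integrable (lebesgue_on {0..T}) g"
  shows "continuous_on {0..T} (\<lambda>t. integral {0..t} g)"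
  by (rule indefinite_integral_continuous_1) (use integrable_on_lebesgue_on[OF assms] in auto)

lemma integral_indicator_ray:
  fixes g :: "real \<Rightarrow> real"
  assumes g: "integrable (lebesgue_on {0..T}) g" and t: "t \<in> {0..T}"
  shows "integral\<^sup>L (lebesgue_on {0..T}) (\<lambda>s. indicator {..t} s * g s) = integral {0..t} g"
    and "integral\<^sup>L (lebesgue_on {0..T}) (\<lambda>s. indicator {t..} s * g s) = integral {t..T} g"
proof -
  have *: "integral\<^sup>L (lebesgue_on {0..T}) (\<lambda>s. indicator A s * g s) = integral {c..d} g"
    if "{0..T} \<inter> A = {c..d}" "0 \<le> c" "d \<le> T" for A c d
  proof -
    have "(\<lambda>s. indicator {0..T} s * (indicator A s * g s)) = (\<lambda>s. indicator {c..d} s * g s)"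
      unfolding that(1)[symmetric] by (auto simp: indicator_def)
    then have "integral\<^sup>L (lebesgue_on {0..T}) (\<lambda>s. indicator A s * g s) = integral\<^sup>L (lebesgue_on {c..d}) g"
      by (simp add: integral_restrict_space)
    also have "integrable (lebesgue_on {c..d}) g"
      by (rule integrable_subinterval[OF g]) (use that in auto)
    then have "integral\<^sup>L (lebesgue_on {c..d}) g = integral {c..d} g"
      by (rule lebesgue_on_Icc_eq_integral)
    finally show ?thesis .
  qed
  show "integral\<^sup>L (lebesgue_on {0..T}) (\<lambda>s. indicator {..t} s * g s) = integral {0..t} g"
    "integral\<^sup>L (lebesgue_on {0..T}) (\<lambda>s. indicator {t..} s * g s) = integral {t..T} g"
    by (rule *, use t in auto)+
qed

text \<open>\<open>g\<close> is merely integrable, so its primitive need not be differentiable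
  everywhere; Fubini over the triangle s \<le> t replaces the product rule.\<close>

theorem integration_by_parts_primitive:
  fixes g \<phi> \<phi>' :: "real \<Rightarrow> real"
  assumes g: "integrable (lebesgue_on {0..T}) g" and T: "0 \<le> T"
    and \<phi>: "\<And>t. t \<in> {0..T} \<Longrightarrow> (\<phi> has_real_derivative \<phi>' t) (at t within {0..T})"
    and \<phi>': "continuous_on {0..T} \<phi>'"
  shows "integral\<^sup>L (lebesgue_on {0..T}) (\<lambda>t. integral {0..t} g * \<phi>' t) =
    integral {0..T} g * \<phi> T - integral\<^sup>L (lebesgue_on {0..T}) (\<lambda>s. g s * \<phi> s)"
proof -
  let ?M = "lebesgue_on {0..T}"
  interpret M: finite_measure ?M by (rule finite_measure_lebesgue_on_Icc)
  interpret MM: pair_sigma_finite ?M ?M ..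
  have h: "integrable ?M \<phi>'" using \<phi>' by (rule continuous_imp_integrable_real)
  have c\<phi>: "continuous_on {0..T} \<phi>" using \<phi> by (rule DERIV_continuous_on)
  have [measurable]: "g \<in> borel_measurable ?M" "\<phi>' \<in> borel_measurable ?M"
    using g h by auto
  have m: "(\<lambda>p. fst p) \<in> borel_measurable (?M \<Otimes>\<^sub>M ?M)" "(\<lambda>p. snd p) \<in> borel_measurable (?M \<Otimes>\<^sub>M ?M)"
    using measurable_compose[OF measurable_fst id_measurable_lebesgue_on]
      measurable_compose[OF measurable_snd id_measurable_lebesgue_on] by auto
  have prod: "integrable (?M \<Otimes>\<^sub>M ?M) (\<lambda>p. g (fst p) * \<phi>' (snd p))"
  proof (rule MM.Fubini_integrable)
    show "integrable ?M (\<lambda>x. LINT y|?M. norm (g (fst (x, y)) * \<phi>' (snd (x, y))))"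
      using g by (simp add: abs_mult)
    show "AE x in ?M. integrable ?M (\<lambda>y. g (fst (x, y)) * \<phi>' (snd (x, y)))"
      using h by simp
  qed measurable
  define f where "f s t = indicator {..t} s * (g s * \<phi>' t)" for s t
  have f: "integrable (?M \<Otimes>\<^sub>M ?M) (case_prod f)"
  proof (rule Bochner_Integration.integrable_bound[OF prod])
    have "{p \<in> space (?M \<Otimes>\<^sub>M ?M). fst p \<le> snd p} \<in> sets (?M \<Otimes>\<^sub>M ?M)"
      using m by (rule borel_measurable_le)
    then have "(\<lambda>p. if fst p \<le> snd p then g (fst p) * \<phi>' (snd p) else 0) \<in> borel_measurable (?M \<Otimes>\<^sub>M ?M)"
      by (intro measurable_If) auto
    moreover have "case_prod f = (\<lambda>p. if fst p \<le> snd p then g (fst p) * \<phi>' (snd p) else 0)"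
      by (auto simp: f_def indicator_def)
    ultimately show "case_prod f \<in> borel_measurable (?M \<Otimes>\<^sub>M ?M)" by simp
    show "AE p in ?M \<Otimes>\<^sub>M ?M. norm (case_prod f p) \<le> norm (g (fst p) * \<phi>' (snd p))"
      by (auto simp: f_def indicator_def)
  qed
  have "integral\<^sup>L ?M (\<lambda>t. integral {0..t} g * \<phi>' t) = (\<integral>t. (\<integral>s. f s t \<partial>?M) \<partial>?M)"
  proof (rule Bochner_Integration.integral_cong[OF refl])
    fix t assume "t \<in> space ?M"
    then have t: "t \<in> {0..T}" by simp
    have "(\<integral>s. f s t \<partial>?M) = (\<integral>s. (indicator {..t} s * g s) * \<phi>' t \<partial>?M)"
      by (simp add: f_def mult.assoc)
    also have "\<dots> = integral {0..t} g * \<phi>' t"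
      using integral_indicator_ray(1)[OF g t] by simp
    finally show "integral {0..t} g * \<phi>' t = (\<integral>s. f s t \<partial>?M)" by simp
  qed
  also have "\<dots> = (\<integral>s. (\<integral>t. f s t \<partial>?M) \<partial>?M)"
    by (rule MM.Fubini_integral[OF f])
  also have "\<dots> = integral\<^sup>L ?M (\<lambda>s. g s * \<phi> T - g s * \<phi> s)"
  proof (rule Bochner_Integration.integral_cong[OF refl])
    fix s assume "s \<in> space ?M"
    then have s: "s \<in> {0..T}" by simp
    have "(\<phi>' has_integral \<phi> T - \<phi> s) {s..T}"
      using s by (intro fundamental_theorem_of_calculus)
        (auto intro!: DERIV_subset[OF \<phi>] simp flip: has_real_derivative_iff_has_vector_derivative)
    then have *: "integral {s..T} \<phi>' = \<phi> T - \<phi> s" by (rule integral_unique)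
    have "(\<lambda>t. f s t) = (\<lambda>t. g s * (indicator {s..} t * \<phi>' t))"
      by (auto simp: f_def indicator_def)
    then show "(\<integral>t. f s t \<partial>?M) = g s * \<phi> T - g s * \<phi> s"
      using integral_indicator_ray(2)[OF h s] * by (simp add: right_diff_distrib)
  qed
  also have "\<dots> = integral {0..T} g * \<phi> T - integral\<^sup>L ?M (\<lambda>s. g s * \<phi> s)"
  proof -
    have "(\<lambda>s. \<phi> s * g s) absolutely_integrable_on {0..T}"
    proof (rule absolutely_integrable_bounded_measurable_product_real)
      show "\<phi> \<in> borel_measurable ?M" using continuous_imp_integrable_real[OF c\<phi>] by auto
      show "bounded (\<phi> ` {0..T})"
        by (intro compact_imp_bounded compact_continuous_image c\<phi>) auto
      show "g absolutely_integrable_on {0..T}"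
        using g by (simp add: set_integrable_def integrable_restrict_space)
    qed auto
    then have "integrable ?M (\<lambda>s. g s * \<phi> s)"
      by (simp add: set_integrable_def integrable_restrict_space mult.commute)
    then show ?thesis
      using g lebesgue_on_Icc_eq_integral[OF g] by (subst Bochner_Integration.integral_diff) auto
  qed
  finally show ?thesis .
qed

section \<open>Calculus of test functions and the du Bois-Reymond lemma\<close>

lemma test_function_zero_outside:
  assumes "0 < T" "\<phi> \<in> test_functions {0..T}" "x \<notin> {0<..<T}"
  shows "\<phi> x = 0"
  using assms by (auto simp: test_functions_iff)

lemma test_function_deriv:
  assumes T: "0 < T" and \<phi>: "\<phi> \<in> test_functions {0..T}"
  shows "deriv \<phi> \<in> test_functions {0..T}"
proof -
  have "(deriv ^^ n) (deriv \<phi>) differentiable at x" for n x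
    using \<phi> T by (auto simp: test_functions_iff dest!: spec[of _ "Suc n"] simp: funpow_swap1)
  moreover obtain a b where ab: "0 < a" "a < b" "b < T" "\<And>x. x \<notin> {a..b} \<Longrightarrow> \<phi> x = 0"
    using \<phi> T by (auto simp: test_functions_iff)
  moreover have "deriv \<phi> x = 0" if "x \<notin> {a..b}" for x
  proof (rule DERIV_imp_deriv, rule DERIV_cong_ev[THEN iffD2, OF refl _ refl DERIV_const])
    have "eventually (\<lambda>z. z \<in> - {a..b}) (nhds x)"
      using that by (intro eventually_nhds_in_open) auto
    then show "\<forall>\<^sub>F z in nhds x. \<phi> z = 0" by eventually_elim (use ab in auto)
  qed
  ultimately show ?thesis using T by (auto simp: test_functions_iff)
qed

lemma test_function_diff:
  assumes T: "0 < T" and f: "f \<in> test_functions {0..T}" and h: "h \<in> test_functions {0..T}"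
  shows "(\<lambda>x. f x - k * h x) \<in> test_functions {0..T}"
proof -
  have df: "(deriv ^^ n) f differentiable at x" and dh: "(deriv ^^ n) h differentiable at x" for n x
    using f h T by (auto simp: test_functions_iff)
  have eq: "(deriv ^^ n) (\<lambda>x. f x - k * h x) = (\<lambda>x. (deriv ^^ n) f x - k * (deriv ^^ n) h x)" for n
  proof (induction n)
    case (Suc n)
    have "deriv (\<lambda>x. (deriv ^^ n) f x - k * (deriv ^^ n) h x) x = deriv ((deriv ^^ n) f) x - k * deriv ((deriv ^^ n) h) x" for x
      using df[of n x] dh[of n x]
      by (intro DERIV_imp_deriv DERIV_diff DERIV_cmult) (auto simp: DERIV_deriv_iff_real_differentiable)
    then show ?case using Suc by auto
  qed simp
  have "(deriv ^^ n) (\<lambda>x. f x - k * h x) differentiable at x" for n x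
    unfolding eq using df dh by (intro derivative_intros)
  moreover obtain a b where ab: "0 < a" "a < b" "b < T" "\<And>x. x \<notin> {a..b} \<Longrightarrow> f x = 0"
    using f T by (auto simp: test_functions_iff)
  moreover obtain c d where cd: "0 < c" "c < d" "d < T" "\<And>x. x \<notin> {c..d} \<Longrightarrow> h x = 0"
    using h T by (auto simp: test_functions_iff)
  moreover have "f x - k * h x = 0" if "x \<notin> {min a c..max b d}" for x
  proof -
    have "x \<notin> {a..b}" "x \<notin> {c..d}" using that by auto
    then show ?thesis using ab(4) cd(4) by simp
  qed
  moreover have "0 < min a c" "min a c < max b d" "max b d < T" using ab cd by auto
  ultimately show ?thesis using T unfolding test_functions_iff[OF T] by blast
qed

text \<open>Mean value 0 is exactly what makes the primitive vanish again to the right of the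
  support.\<close>

lemma test_function_antiderivative:
  assumes T: "0 < T" and \<psi>: "\<psi> \<in> test_functions {0..T}" and I0: "integral {0..T} \<psi> = 0"
  obtains \<phi> where "\<phi> \<in> test_functions {0..T}" "deriv \<phi> = \<psi>"
proof -
  obtain a b where ab: "0 < a" "a < b" "b < T" "\<And>x. x \<notin> {a..b} \<Longrightarrow> \<psi> x = 0"
    using \<psi> T by (auto simp: test_functions_iff)
  define \<phi> where "\<phi> x = integral {0..x} \<psi>" for x
  have int: "\<psi> integrable_on {c..d}" for c d
    by (intro integrable_continuous_interval test_function_continuous(1)[OF \<psi>])
  have zero: "integral {c..d} \<psi> = 0" if "d < a \<or> b < c" for c d
    using integral_cong[of "{c..d}" \<psi> "\<lambda>_. 0"] ab that by auto
  have left: "\<phi> x = 0" if "x < a" for x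
    using zero[of x 0] that by (simp add: \<phi>_def)
  have right: "\<phi> x = 0" if "b < x" for x
  proof -
    \<comment> \<open>The hypothesis \<open>I0\<close> concerns [0, T] only, so \<open>x\<close> is
      compared with \<open>T\<close> first.\<close>
    have "\<phi> (max x T) = 0"
    proof (cases "x \<le> T")
      case False
      then have "integral {0..T} \<psi> + integral {T..x} \<psi> = integral {0..x} \<psi>"
        using T by (intro Henstock_Kurzweil_Integration.integral_combine int) auto
      then show ?thesis using I0 zero[of x T] ab False by (simp add: \<phi>_def max_def)
    qed (use I0 in \<open>simp add: \<phi>_def max_def\<close>)
    moreover have "integral {0..x} \<psi> + integral {x..max x T} \<psi> = integral {0..max x T} \<psi>"
      using that ab by (intro Henstock_Kurzweil_Integration.integral_combine int) auto
    ultimately show ?thesis using zero[of "max x T" x] that by (simp add: \<phi>_def)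
  qed
  have der: "(\<phi> has_real_derivative \<psi> x) (at x)" for x
  proof (cases "x < a")
    case True
    have "eventually (\<lambda>z. z \<in> {..<a}) (nhds x)"
      using True by (intro eventually_nhds_in_open) auto
    then have "\<forall>\<^sub>F z in nhds x. \<phi> z = 0" by eventually_elim (use left in auto)
    then have "(\<phi> has_real_derivative 0) (at x)"
      using DERIV_cong_ev[of x x \<phi> "\<lambda>_. 0" 0 0] by simp
    then show ?thesis using ab(4)[of x] True by simp
  next
    case False
    then have "((\<lambda>y. integral {0..y} \<psi>) has_real_derivative \<psi> x) (at x within {0..x + 1})"
      using ab by (intro integral_has_real_derivative test_function_continuous(1)[OF \<psi>]) auto
    then show ?thesis
      using at_within_Icc_at[of 0 x "x + 1"] False ab by (simp add: \<phi>_def[abs_def])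
  qed
  then have d: "deriv \<phi> = \<psi>" by (intro ext DERIV_imp_deriv)
  have "(deriv ^^ n) \<phi> differentiable at x" for n x
  proof (cases n)
    case (Suc k)
    have "(deriv ^^ k) \<psi> differentiable at x" using \<psi> T by (simp add: test_functions_iff)
    then show ?thesis using d by (simp add: Suc funpow_swap1)
  qed (use der in \<open>auto simp: real_differentiable_def\<close>)
  then have "\<phi> \<in> test_functions {0..T}"
    unfolding test_functions_iff[OF T] using ab left right by (intro conjI exI[of _ a] exI[of _ b]) auto
  then show ?thesis using d that by blast
qed

lemma integrable_imp_locally_integrable:
  assumes "integrable (lebesgue_on {0..T}) g"
  shows "locally_integrable {0..T} g"
  unfolding locally_integrable_def
proof (intro allI impI)
  fix K :: "real set" assume K: "compact K \<and> K \<subseteq> interior {0..T}"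
  have "g absolutely_integrable_on {0..T}"
    using assms by (simp add: set_integrable_def integrable_restrict_space)
  then show "g absolutely_integrable_on K"
    by (rule set_integrable_subset) (use K interior_subset[of "{0..T}"] in \<open>auto intro: fmeasurableD lmeasurable_compact\<close>)
qed

lemma locally_integrable_times_test:
  assumes T: "0 < T" and g: "locally_integrable {0..T} g" and \<phi>: "\<phi> \<in> test_functions {0..T}"
  shows "integrable (lebesgue_on {0..T}) (\<lambda>x. g x * \<phi> x)"
proof -
  obtain a b where ab: "0 < a" "a < b" "b < T" "\<And>x. x \<notin> {a..b} \<Longrightarrow> \<phi> x = 0"
    using \<phi> T by (auto simp: test_functions_iff)
  have c: "continuous_on {a..b} \<phi>" using test_function_continuous(1)[OF \<phi>] .
  have "(\<lambda>s. \<phi> s * g s) absolutely_integrable_on {a..b}"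
  proof (rule absolutely_integrable_bounded_measurable_product_real)
    show "\<phi> \<in> borel_measurable (lebesgue_on {a..b})" using continuous_imp_integrable_real[OF c] by auto
    show "bounded (\<phi> ` {a..b})"
      by (intro compact_imp_bounded compact_continuous_image c) auto
    show "g absolutely_integrable_on {a..b}" by (rule locally_integrable_Icc[OF g ab(1,3)])
  qed auto
  then have "integrable lebesgue (\<lambda>x. indicator {a..b} x *\<^sub>R (\<phi> x * g x))" by (simp add: set_integrable_def)
  also have "(\<lambda>x. indicator {a..b} x *\<^sub>R (\<phi> x * g x)) = (\<lambda>x. indicator {0..T} x *\<^sub>R (g x * \<phi> x))"
  proof
    fix x show "indicator {a..b} x *\<^sub>R (\<phi> x * g x) = indicator {0..T} x *\<^sub>R (g x * \<phi> x)"
      using ab by (cases "x \<in> {a..b}") (auto simp: indicator_def)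
  qed
  finally show ?thesis by (simp add: integrable_restrict_space)
qed

text \<open>Any test function becomes a derivative of a test function after subtracting a multiple
  of one fixed bump \<beta>; so \<open>h\<close> minus a constant is orthogonal to all of
  them.\<close>

theorem du_bois_reymond:
  assumes T: "0 < T" and h: "integrable (lebesgue_on {0..T}) h"
    and zero: "\<And>\<phi>. \<phi> \<in> test_functions {0..T} \<Longrightarrow> integral\<^sup>L (lebesgue_on {0..T}) (\<lambda>x. h x * deriv \<phi> x) = 0"
  obtains c where "AE x in lebesgue_on {0..T}. h x = c"
proof -
  let ?M = "lebesgue_on {0..T}"
  interpret M: finite_measure ?M by (rule finite_measure_lebesgue_on_Icc)
  define \<beta> where "\<beta> = bump 1 (T/4) (T/2) 1 0"
  have \<beta>: "\<beta> \<in> test_functions {0..T}" unfolding \<beta>_def by (rule bump_test) (use T in auto)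
  have \<beta>c: "continuous_on {0..T} \<beta>" by (rule test_function_continuous(1)[OF \<beta>])
  define B where "B = integral {0..T} \<beta>"
  have "B \<noteq> 0"
  proof
    assume "B = 0"
    then have "(\<beta> has_integral 0) {0..T}"
      unfolding B_def by (metis \<beta>c integrable_continuous_interval integrable_integral)
    then have "\<beta> (T/3) = 0"
      using T \<beta>c bump_range[of 1 "T/4" "T/2"]
      by (intro has_integral_0_cbox_imp_0[of 0 T \<beta>]) (auto simp: \<beta>_def)
    then show False using T by (simp add: \<beta>_def bump_def)
  qed
  \<comment> \<open>The \<beta>-weighted mean of \<open>h\<close>, which is the only possible
    constant.\<close>
  define c where "c = integral\<^sup>L ?M (\<lambda>x. h x * \<beta> x) / B"
  have lh: "locally_integrable {0..T} h" by (rule integrable_imp_locally_integrable[OF h])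
  have lhc: "locally_integrable {0..T} (\<lambda>x. h x - c)"
    by (rule integrable_imp_locally_integrable) (use h in simp)
  have "AE x in ?M. h x - c = 0"
  proof (rule fundamental_lemma[OF T lhc])
    fix \<psi> assume \<psi>: "\<psi> \<in> test_functions {0..T}"
    define k where "k = integral {0..T} \<psi> / B"
    have \<psi>i: "\<psi> integrable_on {0..T}" and \<beta>i: "\<beta> integrable_on {0..T}"
      by (rule integrable_continuous_interval[OF test_function_continuous(1)[OF \<psi>]],
          rule integrable_continuous_interval[OF test_function_continuous(1)[OF \<beta>]])
    have \<psi>b: "(\<lambda>x. \<psi> x - k * \<beta> x) \<in> test_functions {0..T}" by (rule test_function_diff[OF T \<psi> \<beta>])
    have "integral {0..T} (\<lambda>x. \<psi> x - k * \<beta> x) = integral {0..T} \<psi> - k * integral {0..T} \<beta>"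
      using \<psi>i \<beta>i by (subst integral_diff) (auto intro: integrable_on_mult_right)
    then have "integral {0..T} (\<lambda>x. \<psi> x - k * \<beta> x) = 0"
      using \<open>B \<noteq> 0\<close> by (simp add: k_def B_def)
    then obtain \<phi> where "\<phi> \<in> test_functions {0..T}" "deriv \<phi> = (\<lambda>x. \<psi> x - k * \<beta> x)"
      using test_function_antiderivative[OF T \<psi>b] by blast
    then have "integral\<^sup>L ?M (\<lambda>x. h x * (\<psi> x - k * \<beta> x)) = 0" using zero by metis
    moreover have "(\<lambda>x. h x * (\<psi> x - k * \<beta> x)) = (\<lambda>x. h x * \<psi> x - k * (h x * \<beta> x))"
      by (auto simp: algebra_simps)
    ultimately have 1: "integral\<^sup>L ?M (\<lambda>x. h x * \<psi> x) = k * integral\<^sup>L ?M (\<lambda>x. h x * \<beta> x)"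
      using locally_integrable_times_test[OF T lh \<psi>] locally_integrable_times_test[OF T lh \<beta>] by simp
    have "integral\<^sup>L ?M (\<lambda>x. (h x - c) * \<psi> x) = integral\<^sup>L ?M (\<lambda>x. h x * \<psi> x) - c * integral\<^sup>L ?M \<psi>"
      using locally_integrable_times_test[OF T lh \<psi>] continuous_imp_integrable_real[OF test_function_continuous(1)[OF \<psi>]]
      by (simp add: left_diff_distrib)
    also have "integral\<^sup>L ?M \<psi> = k * B"
      using lebesgue_on_Icc_eq_integral[OF continuous_imp_integrable_real[OF test_function_continuous(1)[OF \<psi>]]] \<open>B \<noteq> 0\<close>
      by (simp add: k_def)
    also have "integral\<^sup>L ?M (\<lambda>x. h x * \<psi> x) - c * (k * B) = 0"
      using 1 \<open>B \<noteq> 0\<close> by (simp add: c_def)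
    finally show "integral\<^sup>L ?M (\<lambda>x. (h x - c) * \<psi> x) = 0" .
  qed
  then have "AE x in ?M. h x = c" by simp
  then show ?thesis by (rule that)
qed

text \<open>Boundary terms vanish with \<phi>, and \<alpha> drops out because
  \<open>deriv \<phi>\<close> has integral 0.\<close>

lemma weak_deriv_primitive:
  assumes T: "0 < T" and g: "integrable (lebesgue_on {0..T}) g" and \<phi>: "\<phi> \<in> test_functions {0..T}"
  shows "integral\<^sup>L (lebesgue_on {0..T}) (\<lambda>t. (\<alpha> + integral {0..t} g) * deriv \<phi> t) =
    - integral\<^sup>L (lebesgue_on {0..T}) (\<lambda>t. g t * \<phi> t)"
proof -
  let ?M = "lebesgue_on {0..T}"
  have d: "continuous_on {0..T} (deriv \<phi>)"
    by (rule test_function_continuous(1)[OF test_function_deriv[OF T \<phi>]])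
  have z: "\<phi> 0 = 0" "\<phi> T = 0" using test_function_zero_outside[OF T \<phi>] by auto
  have der: "(\<phi> has_real_derivative deriv \<phi> t) (at t within {0..T})" for t
    using test_function_continuous(2)[OF \<phi>] by (rule has_field_derivative_at_within)
  have "integral\<^sup>L ?M (\<lambda>t. integral {0..t} g * deriv \<phi> t) = - integral\<^sup>L ?M (\<lambda>t. g t * \<phi> t)"
    using integration_by_parts_primitive[OF g _ der d] T z by simp
  moreover have "integral\<^sup>L ?M (deriv \<phi>) = 0"
  proof -
    have "(deriv \<phi> has_integral \<phi> T - \<phi> 0) {0..T}"
      using T der by (intro fundamental_theorem_of_calculus)
        (auto simp flip: has_real_derivative_iff_has_vector_derivative)
    then show ?thesis
      using z lebesgue_on_Icc_eq_integral[OF continuous_imp_integrable_real[OF d]] by (simp add: integral_unique)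
  qed
  moreover have "integrable ?M (\<lambda>t. integral {0..t} g * deriv \<phi> t)" "integrable ?M (\<lambda>t. \<alpha> * deriv \<phi> t)"
    by (intro continuous_imp_integrable_real continuous_intros integrable_imp_continuous_primitive g d)+
  ultimately show ?thesis by (simp add: distrib_right)
qed

section \<open>The second-order Sobolev space\<close>

text \<open>This allows the norm, defined through the arbitrary choice in \<open>weak_deriv\<close>,
  to be computed from any known weak derivative.\<close>

lemma weak_deriv_unique:
  assumes T: "0 < T" and v: "has_weak_deriv k {0..T} u v" and v': "has_weak_deriv k {0..T} u v'"
  shows "AE x in lebesgue_on {0..T}. v x = v' x"
proof -
  have l: "locally_integrable {0..T} v" "locally_integrable {0..T} v'"
    using v v' by (auto simp: has_weak_deriv_def)
  have "AE x in lebesgue_on {0..T}. v x - v' x = 0"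
  proof (rule fundamental_lemma[OF T])
    show "locally_integrable {0..T} (\<lambda>x. v x - v' x)"
      using l by (auto simp: locally_integrable_def)
    fix \<phi> assume \<phi>: "\<phi> \<in> test_functions {0..T}"
    have "(-1) ^ k * integral\<^sup>L (lebesgue_on {0..T}) (\<lambda>x. v x * \<phi> x) =
        (-1) ^ k * integral\<^sup>L (lebesgue_on {0..T}) (\<lambda>x. v' x * \<phi> x)"
      using v v' \<phi> by (simp add: has_weak_deriv_def)
    then show "integral\<^sup>L (lebesgue_on {0..T}) (\<lambda>x. (v x - v' x) * \<phi> x) = 0"
      using locally_integrable_times_test[OF T l(1) \<phi>] locally_integrable_times_test[OF T l(2) \<phi>]
      by (simp add: left_diff_distrib)
  qed
  then show ?thesis by simp
qed

text \<open>Measurability passes from \<open>v\<close> to \<open>u\<close> by completeness of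
  Lebesgue measure. It is applied with \<open>u\<close> the chosen weak derivative, which is given
  only as locally integrable.\<close>

lemma Lp_norm_cong_AE:
  assumes v: "v \<in> borel_measurable (lebesgue_on {0..T})" and eq: "AE x in lebesgue_on {0..T}. v x = u x"
  shows "Lp_norm p {0..T} u = Lp_norm p {0..T} v"
proof -
  let ?M = "lebesgue_on {0..T}"
  have "(\<lambda>x. if x \<in> {0..T} then v x else 0) \<in> borel_measurable lebesgue"
    using v by (subst borel_measurable_if) auto
  moreover have "AE x in lebesgue. (if x \<in> {0..T} then v x else 0) = (if x \<in> {0..T} then u x else 0)"
    using eq by (simp add: AE_restrict_space_iff)
  ultimately have "(\<lambda>x. if x \<in> {0..T} then u x else 0) \<in> borel_measurable lebesgue"
    by (rule borel_measurable_AE)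
  then have u: "u \<in> borel_measurable ?M" by (subst (asm) borel_measurable_if) auto
  have "integral\<^sup>L ?M (\<lambda>x. \<bar>u x\<bar> powr p) = integral\<^sup>L ?M (\<lambda>x. \<bar>v x\<bar> powr p)"
  proof (rule integral_cong_AE)
    show "(\<lambda>x. \<bar>u x\<bar> powr p) \<in> borel_measurable ?M" "(\<lambda>x. \<bar>v x\<bar> powr p) \<in> borel_measurable ?M"
      using u v by measurable
    show "AE x in ?M. \<bar>u x\<bar> powr p = \<bar>v x\<bar> powr p" using eq by eventually_elim simp
  qed
  then show ?thesis by (simp add: Lp_norm_def)
qed

lemma Lp_space_integrable:
  assumes p: "1 \<le> p" and u: "u \<in> Lp_space p {0..T}"
  shows "integrable (lebesgue_on {0..T}) u"
proof (rule Bochner_Integration.integrable_bound)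
  interpret M: finite_measure "lebesgue_on {0..T}" by (rule finite_measure_lebesgue_on_Icc)
  show "integrable (lebesgue_on {0..T}) (\<lambda>x. 1 + \<bar>u x\<bar> powr p)"
    using u by (simp add: Lp_space_def)
  show "u \<in> borel_measurable (lebesgue_on {0..T})" using u by (simp add: Lp_space_def)
  have "\<bar>y\<bar> \<le> 1 + \<bar>y\<bar> powr p" for y :: real
  proof (cases "\<bar>y\<bar> \<le> 1")
    case False
    then have "\<bar>y\<bar> powr 1 \<le> \<bar>y\<bar> powr p" using p by (intro powr_mono) auto
    then show ?thesis using False by simp
  qed (simp add: add_increasing2)
  then show "AE x in lebesgue_on {0..T}. norm (u x) \<le> norm (1 + \<bar>u x\<bar> powr p)"
    by (auto simp: abs_of_nonneg add_nonneg_nonneg)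
qed

lemma continuous_Lp_space:
  assumes u: "continuous_on {0..T} u" and p: "0 < p"
  shows "u \<in> Lp_space p {0..T}"
    and "integral\<^sup>L (lebesgue_on {0..T}) (\<lambda>x. \<bar>u x\<bar> powr p) = integral {0..T} (\<lambda>x. \<bar>u x\<bar> powr p)"
proof -
  have "continuous_on {0..T} (\<lambda>x. \<bar>u x\<bar> powr p)"
    using p by (intro continuous_intros continuous_on_powr' u) auto
  from continuous_imp_integrable_real[OF this] continuous_imp_integrable_real[OF u]
  show "u \<in> Lp_space p {0..T}"
    "integral\<^sup>L (lebesgue_on {0..T}) (\<lambda>x. \<bar>u x\<bar> powr p) = integral {0..T} (\<lambda>x. \<bar>u x\<bar> powr p)"
    by (auto simp: Lp_space_def intro: lebesgue_on_Icc_eq_integral)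
qed

lemma integral_cong_AE_Icc:
  fixes f g :: "real \<Rightarrow> real"
  assumes f: "integrable (lebesgue_on {0..T}) f" and g: "integrable (lebesgue_on {0..T}) g"
    and eq: "AE x in lebesgue_on {0..T}. f x = g x" and t: "t \<in> {0..T}"
  shows "integral {0..t} f = integral {0..t} g"
proof -
  have m: "f \<in> borel_measurable (lebesgue_on {0..T})" "g \<in> borel_measurable (lebesgue_on {0..T})"
    using f g by auto
  have i: "(indicator {..t} :: real \<Rightarrow> real) \<in> borel_measurable (lebesgue_on {0..T})"
    by (intro measurable_restrict_space1 measurable_completion) simp
  have "integral\<^sup>L (lebesgue_on {0..T}) (\<lambda>s. indicator {..t} s * f s) =
      integral\<^sup>L (lebesgue_on {0..T}) (\<lambda>s. indicator {..t} s * g s)"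
    using eq m i by (intro integral_cong_AE borel_measurable_times) (auto elim: eventually_mono)
  then show ?thesis using integral_indicator_ray(1)[OF f t] integral_indicator_ray(1)[OF g t] by simp
qed

lemma AE_eq_continuous:
  fixes f g :: "real \<Rightarrow> real"
  assumes T: "0 < T" and f: "continuous_on {0..T} f" and g: "continuous_on {0..T} g"
    and eq: "AE x in lebesgue_on {0..T}. f x = g x" and t: "t \<in> {0..T}"
  shows "f t = g t"
proof -
  have c: "continuous_on {0..T} (\<lambda>x. f x - g x)" using f g by (rule continuous_on_diff)
  have "integral\<^sup>L (lebesgue_on {0..T}) (\<lambda>x. (f x - g x)\<^sup>2) = 0"
    by (rule integral_eq_zero_AE) (use eq in eventually_elim, simp)
  then have "integral {0..T} (\<lambda>x. (f x - g x)\<^sup>2) = 0"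
    using lebesgue_on_Icc_eq_integral[OF continuous_imp_integrable_real[OF continuous_on_power[OF c]]] by simp
  from continuous_zero_if_integral_square_zero[OF c this t T] show ?thesis by simp
qed

text \<open>Two applications of the du Bois-Reymond lemma: the weak derivative \<open>v\<close>
  differs from the primitive \<open>V\<close> of \<open>g\<close> by a constant, and
  \<open>u\<close> from the primitive \<open>W\<close> of \<open>v\<close>. Continuity of
  \<open>u\<close> turns the second relation into one at every point.\<close>

theorem W2D_E:
  assumes p: "1 < p" and T: "0 < T" and u: "u \<in> W2D p T"
  obtains \<alpha> g where "g \<in> Lp_space p {0..T}" "W2D_norm p T u = Lp_norm p {0..T} g"
    "\<And>t. t \<in> {0..T} \<Longrightarrow> (u has_real_derivative \<alpha> + integral {0..t} g) (at t within {0..T})"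
    "u 0 = 0" "u T = 0"
proof -
  let ?M = "lebesgue_on {0..T}"
  interpret M: finite_measure ?M by (rule finite_measure_lebesgue_on_Icc)
  have uc: "continuous_on {0..T} u" and bc: "u 0 = 0" "u T = 0" and uS: "u \<in> Sobolev 2 p {0..T}"
    using u by (auto simp: W2D_def)
  have ex: "\<exists>v\<in>Lp_space p {0..T}. has_weak_deriv j {0..T} u v" if "j \<in> {1..2}" for j
    using uS that unfolding Sobolev_def by blast
  obtain v where v: "v \<in> Lp_space p {0..T}" "has_weak_deriv 1 {0..T} u v"
    using ex[of 1] by auto
  obtain g where g: "g \<in> Lp_space p {0..T}" "has_weak_deriv 2 {0..T} u g"
    using ex[of 2] by auto
  have vi: "integrable ?M v" and gi: "integrable ?M g"
    using Lp_space_integrable[of p] p v g by auto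
  have ui: "integrable ?M u" using uc by (rule continuous_imp_integrable_real)
  define V where "V t = integral {0..t} g" for t
  have Vc: "continuous_on {0..T} V"
    unfolding V_def by (rule integrable_imp_continuous_primitive[OF gi])
  have Vi: "integrable ?M V" using Vc by (rule continuous_imp_integrable_real)
  define W where "W t = integral {0..t} v" for t
  have Wc: "continuous_on {0..T} W"
    unfolding W_def by (rule integrable_imp_continuous_primitive[OF vi])
  have Wi: "integrable ?M W" using Wc by (rule continuous_imp_integrable_real)
  have w1: "integral\<^sup>L ?M (\<lambda>x. u x * deriv \<phi> x) = - integral\<^sup>L ?M (\<lambda>x. v x * \<phi> x)" if "\<phi> \<in> test_functions {0..T}" for \<phi>
    using v(2) that by (simp add: has_weak_deriv_def)
  have w2: "integral\<^sup>L ?M (\<lambda>x. u x * deriv (deriv \<phi>) x) = integral\<^sup>L ?M (\<lambda>x. g x * \<phi> x)" if "\<phi> \<in> test_functions {0..T}" for \<phi>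
    using g(2) that by (simp add: has_weak_deriv_def eval_nat_numeral)
  note prod = locally_integrable_times_test[OF T integrable_imp_locally_integrable test_function_deriv[OF T]]
  have "integral\<^sup>L ?M (\<lambda>x. (v x - V x) * deriv \<phi> x) = 0" if \<phi>: "\<phi> \<in> test_functions {0..T}" for \<phi>
  proof -
    have "integral\<^sup>L ?M (\<lambda>x. v x * deriv \<phi> x) = - integral\<^sup>L ?M (\<lambda>x. g x * \<phi> x)"
      using w1[OF test_function_deriv[OF T \<phi>]] w2[OF \<phi>] by simp
    moreover have "integral\<^sup>L ?M (\<lambda>x. V x * deriv \<phi> x) = - integral\<^sup>L ?M (\<lambda>x. g x * \<phi> x)"
      using weak_deriv_primitive[OF T gi \<phi>, of 0] by (simp add: V_def)
    ultimately show ?thesis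
      using prod[OF vi \<phi>] prod[OF Vi \<phi>] by (simp add: left_diff_distrib)
  qed
  then obtain \<alpha> where "AE x in ?M. v x - V x = \<alpha>"
    using du_bois_reymond[OF T, of "\<lambda>x. v x - V x"] vi Vi by auto
  then have vV: "AE x in ?M. v x = \<alpha> + V x" by (auto elim: eventually_mono)
  have "integral\<^sup>L ?M (\<lambda>x. (u x - W x) * deriv \<phi> x) = 0" if \<phi>: "\<phi> \<in> test_functions {0..T}" for \<phi>
  proof -
    have "integral\<^sup>L ?M (\<lambda>x. W x * deriv \<phi> x) = - integral\<^sup>L ?M (\<lambda>x. v x * \<phi> x)"
      using weak_deriv_primitive[OF T vi \<phi>, of 0] by (simp add: W_def)
    then show ?thesis
      using prod[OF ui \<phi>] prod[OF Wi \<phi>] w1[OF \<phi>] by (simp add: left_diff_distrib)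
  qed
  then obtain \<beta> where "AE x in ?M. u x - W x = \<beta>"
    using du_bois_reymond[OF T, of "\<lambda>x. u x - W x"] ui Wi by auto
  then have "u t - W t = \<beta>" if "t \<in> {0..T}" for t
    using that uc Wc T by (intro AE_eq_continuous[of T "\<lambda>x. u x - W x" "\<lambda>_. \<beta>"]) (auto intro: continuous_intros)
  \<comment> \<open>Both functions vanish at 0, so the constant \<beta> is 0.\<close>
  from this[of 0] this have uW: "u t = W t" if "t \<in> {0..T}" for t
    using that T bc by (fastforce simp: W_def)
  have aVc: "continuous_on {0..T} (\<lambda>s. \<alpha> + V s)" by (intro continuous_intros Vc)
  have der: "(u has_real_derivative \<alpha> + integral {0..t} g) (at t within {0..T})" if t: "t \<in> {0..T}" for t
  proof -
    have "((\<lambda>t. integral {0..t} (\<lambda>s. \<alpha> + V s)) has_real_derivative \<alpha> + V t) (at t within {0..T})"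
      by (rule integral_has_real_derivative[OF aVc t])
    then have "(u has_real_derivative \<alpha> + V t) (at t within {0..T})"
    proof (rule has_field_derivative_transform_within[where d = 1])
      fix s assume s: "s \<in> {0..T}"
      show "integral {0..s} (\<lambda>s. \<alpha> + V s) = u s"
        using integral_cong_AE_Icc[OF vi continuous_imp_integrable_real[OF aVc] vV s] uW[OF s] by (simp add: W_def)
    qed (use t in auto)
    then show ?thesis by (simp add: V_def)
  qed
  have "has_weak_deriv 2 {0..T} u (weak_deriv 2 {0..T} u)"
    unfolding weak_deriv_def by (rule someI[where P = "has_weak_deriv 2 {0..T} u", OF g(2)])
  from weak_deriv_unique[OF T g(2) this]
  have "W2D_norm p T u = Lp_norm p {0..T} g"
    unfolding W2D_norm_def by (rule Lp_norm_cong_AE[rotated]) (use gi in auto)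
  then show ?thesis using that g(1) der bc by blast
qed

text \<open>The converse of \<open>W2D_E\<close>; it places the sine in the space and computes its
  norm.\<close>

theorem W2D_I:
  assumes p: "1 < p" and T: "0 < T" and g: "g \<in> Lp_space p {0..T}"
    and u: "\<And>t. t \<in> {0..T} \<Longrightarrow> (u has_real_derivative \<alpha> + integral {0..t} g) (at t within {0..T})"
    and bc: "u 0 = 0" "u T = 0"
  shows "u \<in> W2D p T" and "W2D_norm p T u = Lp_norm p {0..T} g"
proof -
  let ?M = "lebesgue_on {0..T}"
  have gi: "integrable ?M g" using Lp_space_integrable[of p] p g by auto
  have uc: "continuous_on {0..T} u" using u by (rule DERIV_continuous_on)
  define U where "U t = \<alpha> + integral {0..t} g" for t
  have Uc: "continuous_on {0..T} U"
    unfolding U_def by (intro continuous_intros integrable_imp_continuous_primitive gi)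
  have ui: "integrable ?M u" and Ui: "integrable ?M U"
    using uc Uc by (auto intro: continuous_imp_integrable_real)
  have uU: "u t = 0 + integral {0..t} U" if "t \<in> {0..T}" for t
  proof -
    have "(U has_integral u t - u 0) {0..t}"
      using that by (intro fundamental_theorem_of_calculus)
        (auto intro!: DERIV_subset[OF u] simp: U_def simp flip: has_real_derivative_iff_has_vector_derivative)
    then show ?thesis using bc by (simp add: integral_unique)
  qed
  have 1: "integral\<^sup>L ?M (\<lambda>x. u x * deriv \<phi> x) = - integral\<^sup>L ?M (\<lambda>x. U x * \<phi> x)" if "\<phi> \<in> test_functions {0..T}" for \<phi>
  proof -
    have "integral\<^sup>L ?M (\<lambda>x. u x * deriv \<phi> x) = integral\<^sup>L ?M (\<lambda>x. (0 + integral {0..x} U) * deriv \<phi> x)"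
      by (rule Bochner_Integration.integral_cong) (use uU in auto)
    then show ?thesis using weak_deriv_primitive[OF T Ui that, of 0] by simp
  qed
  have 2: "integral\<^sup>L ?M (\<lambda>x. U x * deriv \<phi> x) = - integral\<^sup>L ?M (\<lambda>x. g x * \<phi> x)" if "\<phi> \<in> test_functions {0..T}" for \<phi>
    using weak_deriv_primitive[OF T gi that] by (simp add: U_def)
  have l: "locally_integrable {0..T} u" "locally_integrable {0..T} U" "locally_integrable {0..T} g"
    using ui Ui gi by (auto intro: integrable_imp_locally_integrable)
  have d1: "has_weak_deriv 1 {0..T} u U"
    using l 1 by (simp add: has_weak_deriv_def)
  have d2: "has_weak_deriv 2 {0..T} u g"
    using l 1[OF test_function_deriv[OF T]] 2 by (simp add: has_weak_deriv_def eval_nat_numeral)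
  have "{1..2::nat} = {1, 2}" by auto
  then have "u \<in> Sobolev 2 p {0..T}"
    using d1 d2 g continuous_Lp_space(1)[OF uc, of p] continuous_Lp_space(1)[OF Uc, of p] p
    by (auto simp: Sobolev_def)
  then show "u \<in> W2D p T" using uc bc by (simp add: W2D_def)
  have "has_weak_deriv 2 {0..T} u (weak_deriv 2 {0..T} u)"
    unfolding weak_deriv_def by (rule someI[where P = "has_weak_deriv 2 {0..T} u", OF d2])
  from weak_deriv_unique[OF T d2 this]
  show "W2D_norm p T u = Lp_norm p {0..T} g"
    unfolding W2D_norm_def by (rule Lp_norm_cong_AE[rotated]) (use gi in auto)
qed

theorem Holder_continuous_Lp:
  assumes pq: "1 < p" "1 < q" "1 / p + 1 / q = 1"
    and u: "continuous_on {0..T} u" and g: "g \<in> Lp_space p {0..T}"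
  shows "\<bar>integral\<^sup>L (lebesgue_on {0..T}) (\<lambda>x. g x * u x)\<bar> \<le> Lp_norm q {0..T} u * Lp_norm p {0..T} g"
proof -
  let ?M = "lebesgue_on {0..T}"
  define a where "a = Lp_norm q {0..T} u"
  define b where "b = Lp_norm p {0..T} g"
  have uq: "integrable ?M (\<lambda>x. \<bar>u x\<bar> powr q)" and gp: "integrable ?M (\<lambda>x. \<bar>g x\<bar> powr p)"
    using continuous_Lp_space(1)[OF u, of q] g pq by (auto simp: Lp_space_def)
  have ab: "0 \<le> a" "0 \<le> b" by (auto simp: a_def b_def Lp_norm_def)
  have aq: "a powr q = integral\<^sup>L ?M (\<lambda>x. \<bar>u x\<bar> powr q)" and bp: "b powr p = integral\<^sup>L ?M (\<lambda>x. \<bar>g x\<bar> powr p)"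
    using pq by (simp_all add: a_def b_def Lp_norm_def powr_powr)
  show ?thesis
  proof (cases "a = 0 \<or> b = 0")
    case True
    have "AE x in ?M. g x * u x = 0"
    proof (cases "a = 0")
      case True
      then have "AE x in ?M. \<bar>u x\<bar> powr q = 0"
        using aq pq uq by (subst integral_nonneg_eq_0_iff_AE[symmetric]) auto
      then show ?thesis by eventually_elim simp
    next
      case False
      with True have "AE x in ?M. \<bar>g x\<bar> powr p = 0"
        using bp pq gp by (subst integral_nonneg_eq_0_iff_AE[symmetric]) auto
      then show ?thesis by eventually_elim simp
    qed
    then have "integral\<^sup>L ?M (\<lambda>x. g x * u x) = 0" by (rule integral_eq_zero_AE)
    then show ?thesis using ab by (simp flip: a_def b_def)
  next
    case False
    with ab have ab': "0 < a" "0 < b" by auto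
    \<comment> \<open>Young's inequality for the functions scaled to norm 1; integrating it produces
      the factor 1/p + 1/q = 1.\<close>
    have bound: "norm (g x * u x) \<le> a * b * (\<bar>g x\<bar> powr p / (b powr p * p) + \<bar>u x\<bar> powr q / (a powr q * q))" for x
    proof -
      have "(\<bar>g x\<bar> / b) * (\<bar>u x\<bar> / a) \<le> (\<bar>g x\<bar> / b) powr p / p + (\<bar>u x\<bar> / a) powr q / q"
        using pq ab' by (intro Youngs_inequality) auto
      then have "a * b * ((\<bar>g x\<bar> / b) * (\<bar>u x\<bar> / a)) \<le> a * b * (\<bar>g x\<bar> powr p / (b powr p * p) + \<bar>u x\<bar> powr q / (a powr q * q))"
        using ab' by (intro mult_left_mono) (auto simp: powr_divide)
      then show ?thesis using ab' by (simp add: abs_mult)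
    qed
    have R: "integrable ?M (\<lambda>x. a * b * (\<bar>g x\<bar> powr p / (b powr p * p) + \<bar>u x\<bar> powr q / (a powr q * q)))"
      using uq gp by simp
    have "\<bar>integral\<^sup>L ?M (\<lambda>x. g x * u x)\<bar> \<le> integral\<^sup>L ?M (\<lambda>x. norm (g x * u x))"
      using integral_norm_bound[of ?M "\<lambda>x. g x * u x"] by simp
    also have "\<dots> \<le> integral\<^sup>L ?M (\<lambda>x. a * b * (\<bar>g x\<bar> powr p / (b powr p * p) + \<bar>u x\<bar> powr q / (a powr q * q)))"
      by (intro integral_mono' R bound order_trans[OF norm_ge_zero bound])
    also have "\<dots> = a * b * (b powr p / (b powr p * p) + a powr q / (a powr q * q))"
      using uq gp by (simp add: aq bp)
    also have "\<dots> = a * b" using ab' pq by simp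
    finally show ?thesis by (simp add: a_def b_def)
  qed
qed

section \<open>The norm of the embedding\<close>

context gen_sine
begin

context
  fixes p :: real
  assumes p: "1 < p" and pq: "1 / p + 1 / q = 1"
begin

text \<open>The quotient of the sine: its norm in L^q is A^(1/q), that of its second derivative
  (q/2) A^(1/p), and 1/q - 1/p = 2/q - 1.\<close>

definition K :: real where "K = (2 / q) * A powr (2 / q - 1)"

lemma K_pos: "0 < K"
  using A_pos q by (simp add: K_def)

lemma K_eq: "K = (2 / q) powr (2 / q) * Beta (1 / 2) ((q + 1) / q) powr (1 / q - 1 / p)"
proof -
  have "1 / q - 1 / p = 2 / q - 1" using pq by (simp add: field_simps)
  moreover have "2 / q * (2 / q) powr (2 / q - 1) = (2 / q) powr (2 / q)"
    using q by (simp add: powr_diff)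
  ultimately show ?thesis
    unfolding K_def A_eq_Beta powr_mult mult.assoc[symmetric] by simp
qed

lemma Lp_norm_continuous:
  assumes "continuous_on {0..T} u"
  shows "Lp_norm q {0..T} u = integral {0..T} (\<lambda>x. \<bar>u x\<bar> powr q) powr (1 / q)"
  using continuous_Lp_space(2)[OF assms, of q] q by (simp add: Lp_norm_def)

lemma embedding_bound:
  assumes u: "u \<in> W2D p T"
  shows "Lp_norm q {0..T} u \<le> K * W2D_norm p T u"
    and "u \<in> W2D_nonzero p T \<Longrightarrow> Lp_norm q {0..T} u = K * W2D_norm p T u \<Longrightarrow> 0 < Lp_norm q {0..T} u \<Longrightarrow>
      \<exists>c. c \<noteq> 0 \<and> (\<forall>t\<in>{0..T}. u t = c * S t)"
proof -
  let ?M = "lebesgue_on {0..T}"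
  obtain \<alpha> g where g: "g \<in> Lp_space p {0..T}" and N: "W2D_norm p T u = Lp_norm p {0..T} g"
    and der: "\<And>t. t \<in> {0..T} \<Longrightarrow> (u has_real_derivative \<alpha> + integral {0..t} g) (at t within {0..T})"
    and bc: "u 0 = 0" "u T = 0"
    using W2D_E[OF p T_pos u] by blast
  have gi: "integrable ?M g" using Lp_space_integrable[of p] p g by auto
  have uc: "continuous_on {0..T} u" using der by (rule DERIV_continuous_on)
  define G where "G t = integral {0..t} g" for t
  define U where "U t = \<alpha> + G t" for t
  have Gc: "continuous_on {0..T} G" unfolding G_def by (rule integrable_imp_continuous_primitive[OF gi])
  have Uc: "continuous_on {0..T} U" unfolding U_def by (intro continuous_intros Gc)
  have dU: "\<And>t. t \<in> {0..T} \<Longrightarrow> (u has_real_derivative U t) (at t within {0..T})"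
    using der by (simp add: U_def G_def)
  define D where "D = integral {0..T} (\<lambda>t. (U t)\<^sup>2)"
  define B where "B = integral {0..T} (\<lambda>t. \<bar>u t\<bar> powr q)"
  define L where "L = Lp_norm q {0..T} u"
  have L: "L = B powr (1 / q)" using Lp_norm_continuous[OF uc] by (simp add: L_def B_def)
  have "L\<^sup>2 = B powr (2 / q)" by (simp add: L power2_eq_square flip: powr_add)
  \<comment> \<open>The sharp Poincare bound rewritten in terms of the norm \<open>L\<close> and the
    constant \<open>K\<close>.\<close>
  then have LB: "q / 2 * A * (B / A) powr (2 / q) = L\<^sup>2 / K"
  proof -
    have "A powr (2 / q - 1) * A = A powr (2 / q)" using A_pos by (simp add: powr_diff)
    then have "L\<^sup>2 / K = q / 2 * (A * (L\<^sup>2 / A powr (2 / q)))"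
      using A_pos q by (simp add: K_def field_simps)
    then show ?thesis using \<open>L\<^sup>2 = B powr (2 / q)\<close> by (simp add: powr_divide)
  qed
  \<comment> \<open>Split U^2 = \<alpha> U + G U: the first term integrates to 0 by the boundary
    conditions, the second by parts.\<close>
  have "D = - integral\<^sup>L ?M (\<lambda>x. g x * u x)"
  proof -
    have "integral\<^sup>L ?M (\<lambda>t. G t * U t) = - integral\<^sup>L ?M (\<lambda>x. g x * u x)"
      using integration_by_parts_primitive[OF gi _ dU Uc] T_pos bc by (simp add: G_def)
    moreover have "integral\<^sup>L ?M U = 0"
    proof -
      have "(U has_integral u T - u 0) {0..T}"
        using T_pos dU by (intro fundamental_theorem_of_calculus)
          (auto simp flip: has_real_derivative_iff_has_vector_derivative)
      then show ?thesis
        using bc lebesgue_on_Icc_eq_integral[OF continuous_imp_integrable_real[OF Uc]] by (simp add: integral_unique)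
    qed
    moreover have "D = integral\<^sup>L ?M (\<lambda>t. (U t)\<^sup>2)"
      unfolding D_def by (intro lebesgue_on_Icc_eq_integral[symmetric] continuous_imp_integrable_real continuous_intros Uc)
    moreover have "(\<lambda>t. (U t)\<^sup>2) = (\<lambda>t. \<alpha> * U t + G t * U t)"
      by (auto simp: U_def power2_eq_square algebra_simps)
    moreover have "integrable ?M (\<lambda>t. \<alpha> * U t)" "integrable ?M (\<lambda>t. G t * U t)"
      by (intro continuous_imp_integrable_real continuous_intros Gc Uc)+
    ultimately show ?thesis by simp
  qed
  then have DL: "D \<le> L * W2D_norm p T u"
    using Holder_continuous_Lp[OF p q pq uc g] by (simp add: N L_def)
  have N0: "0 \<le> W2D_norm p T u" by (simp add: W2D_norm_def Lp_norm_def)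
  have P: "L\<^sup>2 / K \<le> D" if nz: "\<exists>t\<in>{0..T}. u t \<noteq> 0"
    unfolding LB[symmetric] D_def B_def by (rule poincare(1)[OF dU Uc bc nz])
  show "Lp_norm q {0..T} u \<le> K * W2D_norm p T u"
  proof (cases "L = 0")
    case True
    then show ?thesis using K_pos N0 by (simp flip: L_def)
  next
    case False
    then have L0: "0 < L" by (simp add: L)
    have "\<exists>t\<in>{0..T}. u t \<noteq> 0"
    proof (rule ccontr)
      assume "\<not> ?thesis"
      then have "B = integral {0..T} (\<lambda>t. 0)" unfolding B_def by (intro integral_cong) auto
      then show False using False L by simp
    qed
    \<comment> \<open>Poincare below and Hoelder above enclose \<open>D\<close>; one factor
      \<open>L\<close> then cancels.\<close>
    then have "L * (L / K) \<le> L * W2D_norm p T u" using P DL by (simp add: power2_eq_square)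
    then have "L / K \<le> W2D_norm p T u" using L0 by (rule mult_left_le_imp_le)
    then show ?thesis using K_pos by (simp add: L_def field_simps)
  qed
  assume "u \<in> W2D_nonzero p T" and eq: "Lp_norm q {0..T} u = K * W2D_norm p T u"
  then have nz: "\<exists>t\<in>{0..T}. u t \<noteq> 0" by (simp add: W2D_nonzero_def)
  have "L\<^sup>2 / K = L * W2D_norm p T u"
    using eq K_pos by (simp add: power2_eq_square flip: L_def)
  \<comment> \<open>The two outer bounds of \<open>D\<close> coincide, so the equality case of
    Poincare applies.\<close>
  then have "D = L\<^sup>2 / K" using P[OF nz] DL by simp
  then have "q / 2 * A * (B / A) powr (2 / q) = D" using LB by simp
  then show "\<exists>c. c \<noteq> 0 \<and> (\<forall>t\<in>{0..T}. u t = c * S t)"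
    using poincare(2)[OF dU Uc bc nz] by (simp add: D_def B_def)
qed

text \<open>Stated for functions that agree with a multiple of \<open>S\<close> on [0, T], since
  values elsewhere do not matter.\<close>

lemma sine_extremal:
  assumes c: "c \<noteq> 0" and u: "\<And>t. t \<in> {0..T} \<Longrightarrow> u t = c * S t"
  shows "u \<in> W2D_nonzero p T" and "0 < W2D_norm p T u" and "Lp_norm q {0..T} u = K * W2D_norm p T u"
proof -
  let ?M = "lebesgue_on {0..T}"
  have RC: "C 0 + integral {0..t} R = C t" if "t \<in> {0..T}" for t
  proof -
    have "(R has_integral C t - C 0) {0..t}"
      using that by (intro fundamental_theorem_of_calculus)
        (auto intro!: DERIV_subset[OF C_deriv] simp flip: has_real_derivative_iff_has_vector_derivative)
    then show ?thesis by (simp add: integral_unique)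
  qed
  have cR: "continuous_on {0..T} (\<lambda>t. c * R t)" by (intro continuous_intros continuous_on_R)
  have cS: "continuous_on {0..T} (\<lambda>t. c * S t)" by (intro continuous_intros continuous_on_S)
  have uc: "continuous_on {0..T} u" using cS by (rule continuous_on_eq) (simp add: u)
  have g: "(\<lambda>t. c * R t) \<in> Lp_space p {0..T}"
    using continuous_Lp_space(1)[OF cR, of p] p by simp
  have der: "(u has_real_derivative c * C 0 + integral {0..t} (\<lambda>t. c * R t)) (at t within {0..T})" if t: "t \<in> {0..T}" for t
  proof -
    have "c * C 0 + integral {0..t} (\<lambda>t. c * R t) = c * C t"
      using RC[OF t] by (simp flip: distrib_left)
    moreover have "((\<lambda>t. c * S t) has_real_derivative c * C t) (at t within {0..T})"
      using S_deriv[OF t] by (rule DERIV_cmult)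
    then have "(u has_real_derivative c * C t) (at t within {0..T})"
      by (rule has_field_derivative_transform_within[where d = 1]) (use t u in auto)
    ultimately show ?thesis by simp
  qed
  have bc: "u 0 = 0" "u T = 0" using u[of 0] u[of T] T_pos by auto
  note W = W2D_I[OF p T_pos g der bc]
  have "u (T/2) \<noteq> 0" using u[of "T/2"] c T_pos by simp
  moreover have "T/2 \<in> {0..T}" using T_pos by simp
  ultimately show "u \<in> W2D_nonzero p T" using W(1) by (auto simp: W2D_nonzero_def)
  \<comment> \<open>Conjugacy makes |u''|^p proportional to |u|^q, so that both norms reduce to
    \<open>A\<close>.\<close>
  have "(q - 1) * p = q" using pq p q by (simp add: field_simps)
  then have R: "\<bar>c * R t\<bar> powr p = (\<bar>c\<bar> * (q / 2)) powr p * \<bar>S t\<bar> powr q" for t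
  proof -
    have "\<bar>c * R t\<bar> = \<bar>c\<bar> * (q / 2) * \<bar>S t\<bar> powr (q - 1)"
      using q by (simp add: R_def abs_mult)
    then show ?thesis
      using \<open>(q - 1) * p = q\<close> by (simp only: powr_mult powr_powr)
  qed
  have N: "W2D_norm p T u = \<bar>c\<bar> * (q / 2) * A powr (1 / p)"
  proof -
    have "integral\<^sup>L ?M (\<lambda>t. \<bar>c * R t\<bar> powr p) = (\<bar>c\<bar> * (q / 2)) powr p * A"
      using continuous_Lp_space(2)[OF cR, of p] p unfolding R by (simp add: A_def)
    then show ?thesis
      using W(2) p q by (simp add: Lp_norm_def powr_mult[of _ A] powr_powr)
  qed
  show "0 < W2D_norm p T u"
    unfolding N by (intro mult_pos_pos) (use c q A_pos in auto)
  have "integral {0..T} (\<lambda>x. \<bar>u x\<bar> powr q) = integral {0..T} (\<lambda>x. \<bar>c\<bar> powr q * \<bar>S x\<bar> powr q)"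
    by (rule integral_cong) (simp add: u abs_mult powr_mult)
  then have "Lp_norm q {0..T} u = \<bar>c\<bar> * A powr (1 / q)"
    using Lp_norm_continuous[OF uc] q by (simp add: A_def[symmetric] powr_mult powr_powr)
  moreover have "A powr (2 / q - 1) * A powr (1 / p) = A powr (1 / q)"
  proof -
    have "2 / q - 1 + 1 / p = 1 / q" using pq by (simp add: field_simps)
    then show ?thesis by (simp flip: powr_add)
  qed
  ultimately show "Lp_norm q {0..T} u = K * W2D_norm p T u"
    using q by (simp add: N K_def)
qed

lemma SUP_quotient: "(SUP f\<in>W2D_nonzero p T. E2_quotient p q T f) = K"
  and bdd_quotient: "bdd_above (E2_quotient p q T ` W2D_nonzero p T)"
proof -
  have le: "E2_quotient p q T f \<le> K" if "f \<in> W2D_nonzero p T" for f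
  proof (cases "W2D_norm p T f = 0")
    case False
    then have "0 < W2D_norm p T f" by (simp add: W2D_norm_def Lp_norm_def)
    then show ?thesis
      using embedding_bound(1)[of f] that
      by (simp add: E2_quotient_def E2_def[abs_def] W2D_nonzero_def pos_divide_le_eq)
  \<comment> \<open>A zero denominator would give the quotient the default value 0, which is below
    \<open>K\<close>.\<close>
  qed (use K_pos in \<open>simp add: E2_quotient_def\<close>)
  have "E2_quotient p q T S = K"
    using sine_extremal(2,3)[of 1 S] by (simp add: E2_quotient_def E2_def[abs_def])
  moreover have "S \<in> W2D_nonzero p T" using sine_extremal(1)[of 1 S] by simp
  ultimately show "(SUP f\<in>W2D_nonzero p T. E2_quotient p q T f) = K"
    using le by (intro cSup_eq_maximum) (auto intro: rev_image_eqI)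
  show "bdd_above (E2_quotient p q T ` W2D_nonzero p T)"
    using le by (intro bdd_aboveI[of _ K]) auto
qed

text \<open>The sine attains the bound with positive norm, so no smaller constant is admissible and
  the infimum is a minimum.\<close>

lemma op_norm_E2: "op_norm (W2D p T) (W2D_norm p T) (Lp_norm q {0..T}) E2 = K"
  unfolding op_norm_def
proof (rule cInf_eq_minimum)
  show "K \<in> {C. 0 \<le> C \<and> (\<forall>x\<in>W2D p T. Lp_norm q {0..T} (E2 x) \<le> C * W2D_norm p T x)}"
    using K_pos embedding_bound(1) by (simp add: E2_def[abs_def])
  fix C' assume C': "C' \<in> {C. 0 \<le> C \<and> (\<forall>x\<in>W2D p T. Lp_norm q {0..T} (E2 x) \<le> C * W2D_norm p T x)}"
  have "S \<in> W2D p T" using sine_extremal(1)[of 1 S] by (simp add: W2D_nonzero_def)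
  then have "Lp_norm q {0..T} S \<le> C' * W2D_norm p T S"
    using C' by (simp add: E2_def[abs_def])
  then have "K * W2D_norm p T S \<le> C' * W2D_norm p T S"
    using sine_extremal(3)[of 1 S] by simp
  then show "K \<le> C'" using sine_extremal(2)[of 1 S] by simp
qed

lemma extremal_iff: "extremal p q T f \<longleftrightarrow> (\<exists>c. c \<noteq> 0 \<and> (\<forall>t\<in>{0..T}. f t = c * S t))"
proof
  assume f: "extremal p q T f"
  then have nz: "f \<in> W2D_nonzero p T" and Q: "E2_quotient p q T f = K"
    by (simp_all add: extremal_def SUP_quotient)
  \<comment> \<open>Division by zero would make the quotient 0, whereas it equals the positive
    \<open>K\<close>.\<close>
  then have "W2D_norm p T f \<noteq> 0" using K_pos by (auto simp: E2_quotient_def)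
  moreover from this have eq: "Lp_norm q {0..T} f = K * W2D_norm p T f"
    using Q by (simp add: E2_quotient_def E2_def[abs_def] field_simps)
  ultimately have "Lp_norm q {0..T} f \<noteq> 0" using K_pos by simp
  then have "0 < Lp_norm q {0..T} f" by (simp add: Lp_norm_def)
  then show "\<exists>c. c \<noteq> 0 \<and> (\<forall>t\<in>{0..T}. f t = c * S t)"
    using embedding_bound(2)[of f] nz eq by (simp add: W2D_nonzero_def)
next
  assume "\<exists>c. c \<noteq> 0 \<and> (\<forall>t\<in>{0..T}. f t = c * S t)"
  then obtain c where c: "c \<noteq> 0" "\<And>t. t \<in> {0..T} \<Longrightarrow> f t = c * S t" by blast
  have "E2_quotient p q T f = K"
    using sine_extremal(2,3)[of c f, OF c] by (simp add: E2_quotient_def E2_def[abs_def])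
  then show "extremal p q T f"
    using sine_extremal(1)[of c f, OF c] by (simp add: extremal_def SUP_quotient)
qed

lemma E2_range: "E2 ` W2D p T \<subseteq> Lp_space q {0..T}"
  using continuous_Lp_space(1)[of T _ q] q by (auto simp: E2_def W2D_def)

end

end

theorem theorem6p1:
  fixes p p' t0 :: real
  assumes "1 < p"
    and "p' = p / (p - 1)"
    and "t0 = gen_pi 2 p'"
  shows "E2 ` W2D p t0 \<subseteq> Lp_space p' {0..t0} \<and>
    bdd_above (E2_quotient p p' t0 ` W2D_nonzero p t0) \<and>
    op_norm (W2D p t0) (W2D_norm p t0) (Lp_norm p' {0..t0}) E2 =
      (SUP f\<in>W2D_nonzero p t0. E2_quotient p p' t0 f) \<and>
    (SUP f\<in>W2D_nonzero p t0. E2_quotient p p' t0 f) =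
      (2 / p') powr (2 / p') * Beta (1 / 2) ((p' + 1) / p') powr (1 / p' - 1 / p) \<and>
    (\<forall>f. extremal p p' t0 f \<longleftrightarrow>
      (\<exists>c. c \<noteq> 0 \<and> (\<forall>t\<in>{0..t0}. f t = c * gen_sin 2 p' t)))"
proof -
  interpret gen_sine p'
    by unfold_locales (use assms(1,2) in \<open>simp add: less_divide_eq\<close>)
  have pq: "1 / p + 1 / p' = 1" using assms(1) by (simp add: assms(2) flip: add_divide_distrib)
  show ?thesis
    unfolding assms(3)
    using E2_range[OF assms(1) pq] bdd_quotient[OF assms(1) pq] op_norm_E2[OF assms(1) pq]
      SUP_quotient[OF assms(1) pq] K_eq[OF assms(1) pq] extremal_iff[OF assms(1) pq]
    by simp
qed

end
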